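(* Let $\mathcal G$ be a connected graph on $n\ge2$ nodes with edge set $\mathcal E_{\mathcal G}$, where each edge $e$ carries a conductance $g_e\ge0$ and a susceptance $b_e>0$; put $\alpha_e=g_e/b_e$. Let $\mathcal G_g$ and $\mathcal G_b$ be the graph $\mathcal G$ with edge weights $g_e$ and $b_e$, respectively, and let $\beta>0$. Then the performance measure of the linearized swing equations with respect to the angle output graph $\mathcal G_g$ is $$\rho_{ss}\big(A^{(1)}_{\mathcal G_b};L_{\mathcal G_g}\oplus 0\big)=\frac{\bar\alpha}{2\beta}(n-1),\qquad \bar\alpha=\frac{\sum_{e\in\mathcal E_{\mathcal G}}\nu_e\alpha_e}{\sum_{e\in\mathcal E_{\mathcal G}}\nu_e}=\frac{\sum_{e\in\mathcal E_{\mathcal G}}\nu_e\alpha_e}{n-1},$$ where $\nu_e=r_e^{(\mathcal G_b)}b_e$ and $r_e^{(\mathcal G_b)}$ is the effective reactance of edge $e$. Furthermore, $$\frac{\alpha_{\min}}{2\beta}(n-1)\ \le\ \rho_{ss}\big(A^{(1)}_{\mathcal G_b};L_{\mathcal G_g}\oplus 0\big)\ \le\ \frac{\alpha_{\max}}{2\beta}(n-1),$$ where $\alpha_{\min}=\min_{e\in\mathcal E_{\mathcal G}}\alpha_e$ and $\alpha_{\max}=\max_{e\in\mathcal E_{\mathcal G}}\alpha_e$.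
   Context: Graphs are finite, simple, undirected. The Laplacian of a weighted graph is (diagonal matrix of weighted degrees) minus (weighted adjacency matrix). The linearized swing equations are $\dot\theta=\omega$, $\dot\omega=-L_{\mathcal G_b}\theta-\beta\omega+\xi$ with $\theta,\omega\in\mathbb R^n$ and $\xi$ a zero-mean white noise with identity covariance, and $A^{(1)}_{\mathcal G_b}=\begin{bmatrix}0&-I\\ L_{\mathcal G_b}&\beta I\end{bmatrix}$. The performance measure (expected total resistive power loss) is $\rho_{ss}(A^{(1)}_{\mathcal G_b};L_{\mathcal G_g}\oplus0)=\lim_{t\to\infty}\mathbb E\big[\sum_{e=\{i,j\}\in\mathcal E_{\mathcal G}}g_e|\theta_i(t)-\theta_j(t)|^2\big]$, which equals $\frac1{2\beta}\mathrm{Tr}(L_{\mathcal G_b}^{\dagger}L_{\mathcal G_g})$ with $\dagger$ the Moore--Penrose pseudo-inverse. For $e=\{i,j\}$, the effective reactance is the effective resistance in $\mathcal G_b$: $r_e^{(\mathcal G_b)}=l^{\dagger}_{ii}+l^{\dagger}_{jj}-l^{\dagger}_{ij}-l^{\dagger}_{ji}$, where $L_{\mathcal G_b}^{\dagger}=[l^{\dagger}_{ij}]$. *)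

theory Defs
  imports "HOL-Probability.Probability"
begin

text \<open>The nodes are the elements of a finite type, and an edge is a two-element set of nodes.\<close>

definition simple_graph :: "'n set set \<Rightarrow> bool" where
  "simple_graph E \<longleftrightarrow> (\<forall>e\<in>E. \<exists>i j. i \<noteq> j \<and> e = {i, j})"

definition graph_connected :: "'n set set \<Rightarrow> bool" where
  "graph_connected E \<longleftrightarrow> (\<forall>i j. (i, j) \<in> {(u, v). {u, v} \<in> E}\<^sup>*)"

definition weighted_adjacency :: "'n::finite set set \<Rightarrow> ('n set \<Rightarrow> real) \<Rightarrow> real^'n^'n" where
  "weighted_adjacency E w = (\<chi> i j. if {i, j} \<in> E then w {i, j} else 0)"

definition weighted_degree :: "'n::finite set set \<Rightarrow> ('n set \<Rightarrow> real) \<Rightarrow> 'n \<Rightarrow> real" where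
  "weighted_degree E w i = (\<Sum>e\<in>{e\<in>E. i \<in> e}. w e)"

definition laplacian :: "'n::finite set set \<Rightarrow> ('n set \<Rightarrow> real) \<Rightarrow> real^'n^'n" where
  "laplacian E w =
     (\<chi> i j. if i = j then weighted_degree E w i else 0) - weighted_adjacency E w"

text \<open>
  The value of a symmetric function of two nodes at an edge. For symmetric \<open>f\<close> it does not
  depend on the order in which the end points are listed.
\<close>

definition edge_value :: "('n \<Rightarrow> 'n \<Rightarrow> real) \<Rightarrow> 'n set \<Rightarrow> real" where
  "edge_value f e = (THE v. \<exists>i j. e = {i, j} \<and> v = f i j)"

lemma edge_value_doubleton:
  assumes "\<And>i j. f i j = f j i"
  shows "edge_value f {i, j} = f i j"
  unfolding edge_value_def
  by (rule the_equality) (use assms in \<open>auto simp: doubleton_eq_iff\<close>)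

text \<open>
  The Moore--Penrose pseudo-inverse of a real matrix, given by the four Penrose conditions,
  which have exactly one solution.
\<close>

definition pseudo_inverse :: "real^'n^'m \<Rightarrow> real^'m^'n" where
  "pseudo_inverse A = (THE X.
     A ** X ** A = A \<and> X ** A ** X = X \<and>
     transpose (A ** X) = A ** X \<and> transpose (X ** A) = X ** A)"

definition effective_reactance ::
    "'n::finite set set \<Rightarrow> ('n set \<Rightarrow> real) \<Rightarrow> 'n set \<Rightarrow> real" where
  "effective_reactance E b = (let P = pseudo_inverse (laplacian E b) in
     edge_value (\<lambda>i j. P $ i $ i + P $ j $ j - P $ i $ j - P $ j $ i))"

text \<open>
  White noise \<open>\<xi>\<close> is not a function of time, so it enters through its integral
  \<open>W t = \<integral>\<^sub>0\<^sup>t \<xi> s ds\<close>. Zero mean and the identity covariance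
  \<open>E (\<xi>\<^sub>i s \<cdot> \<xi>\<^sub>j t) = \<delta>\<^sub>i\<^sub>j \<delta> (t - s)\<close> become the last two conditions below, which in
  particular give \<open>W 0 = 0\<close> almost surely. Gaussianity is not required; a standard
  \<open>n\<close>-dimensional Wiener process satisfies all the conditions.
\<close>

definition integrated_white_noise :: "'w measure \<Rightarrow> (real \<Rightarrow> 'w \<Rightarrow> real^'n) \<Rightarrow> bool" where
  "integrated_white_noise M W \<longleftrightarrow>
     (\<forall>t\<ge>0. W t \<in> borel_measurable M) \<and>
     (AE w in M. continuous_on {0..} (\<lambda>t. W t w)) \<and>
     (\<forall>t\<ge>0. integrable M (\<lambda>w. (norm (W t w))\<^sup>2)) \<and>
     (\<forall>t\<ge>0. \<forall>i. (\<integral>w. W t w $ i \<partial>M) = 0) \<and>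
     (\<forall>s\<ge>0. \<forall>t\<ge>0. \<forall>i j.
        (\<integral>w. W s w $ i * W t w $ j \<partial>M) = (if i = j then min s t else 0))"

text \<open>
  The system \<open>\<theta>' = \<omega>\<close>, \<open>\<omega>' = - L \<theta> - \<beta> \<omega> + \<xi>\<close>, with state matrix \<open>- [0, -I; L, \<beta> I]\<close>, in
  integrated form. As the noise is additive, no stochastic integral is involved and the
  equations hold path by path. The initial state is an arbitrary square-integrable random
  vector, for instance a constant.
\<close>

definition swing_solution ::
    "'w measure \<Rightarrow> real^'n^'n \<Rightarrow> real \<Rightarrow> (real \<Rightarrow> 'w \<Rightarrow> real^'n) \<Rightarrow>
     (real \<Rightarrow> 'w \<Rightarrow> real^'n) \<Rightarrow> (real \<Rightarrow> 'w \<Rightarrow> real^'n) \<Rightarrow> bool" where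
  "swing_solution M L \<beta> W \<theta> \<omega> \<longleftrightarrow>
     (\<forall>t\<ge>0. \<theta> t \<in> borel_measurable M \<and> \<omega> t \<in> borel_measurable M) \<and>
     integrable M (\<lambda>w. (norm (\<theta> 0 w))\<^sup>2) \<and> integrable M (\<lambda>w. (norm (\<omega> 0 w))\<^sup>2) \<and>
     (AE w in M. \<forall>t\<ge>0.
        ((\<lambda>s. \<omega> s w) has_integral (\<theta> t w - \<theta> 0 w)) {0..t} \<and>
        ((\<lambda>s. - (L *v \<theta> s w) - \<beta> *\<^sub>R \<omega> s w) has_integral
           (\<omega> t w - \<omega> 0 w - W t w)) {0..t})"

definition power_loss :: "'n::finite set set \<Rightarrow> ('n set \<Rightarrow> real) \<Rightarrow> real^'n \<Rightarrow> real" where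
  "power_loss E g x = (\<Sum>e\<in>E. g e * edge_value (\<lambda>i j. \<bar>x $ i - x $ j\<bar>\<^sup>2) e)"

definition expected_power_loss ::
    "'w measure \<Rightarrow> 'n::finite set set \<Rightarrow> ('n set \<Rightarrow> real) \<Rightarrow> (real \<Rightarrow> 'w \<Rightarrow> real^'n) \<Rightarrow>
     real \<Rightarrow> real" where
  "expected_power_loss M E g \<theta> t = (\<integral>w. power_loss E g (\<theta> t w) \<partial>M)"

definition performance_measure ::
    "'w measure \<Rightarrow> 'n::finite set set \<Rightarrow> ('n set \<Rightarrow> real) \<Rightarrow> (real \<Rightarrow> 'w \<Rightarrow> real^'n) \<Rightarrow> real"
  where "performance_measure M E g \<theta> = Lim at_top (expected_power_loss M E g \<theta>)"

end

theory Submission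
  imports Defs "HOL-Real_Asymp.Real_Asymp"
begin

text \<open>
  The power loss is a weighted sum of squared phase differences \<open>(d\<^sub>e \<bullet> \<theta>)\<^sup>2\<close> over the edges, where
  \<open>d\<^sub>e\<close> is the difference of the unit vectors at the two ends of \<open>e\<close>. The theorem follows from the
  limit \<open>E (d\<^sub>e \<bullet> \<theta> t)\<^sup>2 \<longlongrightarrow> r\<^sub>e / (2 \<beta>)\<close> for each edge (\<open>edge_second_moment\<close>): summation gives
  \<open>\<Sum>\<^sub>e g\<^sub>e r\<^sub>e / (2 \<beta>) = \<Sum>\<^sub>e \<nu>\<^sub>e \<alpha>\<^sub>e / (2 \<beta>)\<close>, and Foster's theorem \<open>\<Sum>\<^sub>e \<nu>\<^sub>e = n - 1\<close> (\<open>foster\<close>)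
  turns this into the weighted mean of the ratios \<open>\<alpha>\<^sub>e\<close>, with weights \<open>\<nu>\<^sub>e \<ge> 0\<close>. A weighted mean lies
  between the minimum and the maximum.

  For the limit, let \<open>H\<close> solve \<open>H'' + \<beta> H' + L H = 0\<close>, \<open>H 0 = 0\<close>, \<open>H' 0 = d\<^sub>e\<close>. The equations
  are linear with additive noise, so path by path \<open>d\<^sub>e \<bullet> \<theta> t\<close> is a response to the initial state
  plus \<open>\<integral> H' (t - s) \<bullet> W s ds\<close>, integrated from \<open>0\<close> to \<open>t\<close> (\<open>variation_of_constants\<close>). The
  second moment of the latter is \<open>\<integral> |H s|\<^sup>2 ds\<close> over the same interval (\<open>noise_integral_isometry\<close>),
  which uses only the covariance of \<open>W\<close> and Fubini's theorem.

  A spectral decomposition of \<open>L\<close> reduces \<open>H\<close> to scalar damped oscillators. It vanishes in the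
  zero mode, as \<open>d\<^sub>e\<close> is orthogonal to the constants that span the kernel of \<open>L\<close> for a connected
  graph. In a mode with eigenvalue \<open>\<lambda> > 0\<close> the unit response decays and has energy
  \<open>1 / (2 \<beta> \<lambda>)\<close> (\<open>impulse_response_energy\<close>). The total energy is thus \<open>d\<^sub>e \<bullet> L\<^sup>\<dagger> d\<^sub>e / (2 \<beta>)\<close>, and
  \<open>d\<^sub>e \<bullet> L\<^sup>\<dagger> d\<^sub>e\<close> is the effective reactance of \<open>e\<close>. The contribution of the initial state decays
  with \<open>H\<close> and \<open>H'\<close>, whatever its correlation with the noise.
\<close>

section \<open>Spectral theorem\<close>

text \<open>
  A maximiser \<open>v\<close> of the quadratic form on the unit sphere is a critical point. Moving from
  \<open>v\<close> in the direction of the residual \<open>u = l v - f v\<close> changes \<open>l |x|\<^sup>2 - x \<bullet> f x\<close>, which is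
  nonnegative on \<open>S\<close> and zero at \<open>v\<close>, by \<open>2 t |u|\<^sup>2\<close> up to second order in \<open>t\<close>. For small
  negative \<open>t\<close> this has the wrong sign unless \<open>u = 0\<close>.
\<close>

lemma self_adjoint_maximiser_eigenvector:
  fixes f :: "'a::real_inner \<Rightarrow> 'a"
  assumes lin: "linear f"
    and adj: "\<And>x y. f x \<bullet> y = x \<bullet> f y"
    and S: "subspace S" "f ` S \<subseteq> S"
    and v: "v \<in> S" "norm v = 1"
    and max: "\<And>x. x \<in> S \<Longrightarrow> norm x = 1 \<Longrightarrow> x \<bullet> f x \<le> v \<bullet> f v"
  shows "f v = (v \<bullet> f v) *\<^sub>R v"
proof -
  define l where "l = v \<bullet> f v"
  define u where "u = l *\<^sub>R v - f v"
  have uS: "u \<in> S"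
    unfolding u_def using S v by (intro subspace_diff subspace_scale) auto
  have form: "x \<bullet> f x \<le> l * (x \<bullet> x)" if "x \<in> S" for x
  proof (cases "x = 0")
    case True
    then show ?thesis by simp
  next
    case False
    let ?y = "(1 / norm x) *\<^sub>R x"
    have "?y \<bullet> f ?y \<le> l"
      unfolding l_def using False that S by (intro max) (auto simp: subspace_scale)
    moreover have "?y \<bullet> f ?y = (x \<bullet> f x) / (x \<bullet> x)"
      by (simp add: linear_scale[OF lin] dot_square_norm power2_eq_square)
    ultimately have "(x \<bullet> f x) / (x \<bullet> x) \<le> l"
      by linarith
    then show ?thesis
      using False by (simp add: divide_le_eq)
  qed
  have quad: "0 \<le> 2 * t * (u \<bullet> u) + t\<^sup>2 * (l * (u \<bullet> u) - u \<bullet> f u)" for t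
  proof -
    have uu: "u \<bullet> (l *\<^sub>R v - f v) = u \<bullet> u"
      unfolding u_def ..
    have "v + t *\<^sub>R u \<in> S"
      using S v uS by (intro subspace_add subspace_scale)
    from form[OF this] have
      "0 \<le> l * ((v + t *\<^sub>R u) \<bullet> (v + t *\<^sub>R u)) - (v + t *\<^sub>R u) \<bullet> f (v + t *\<^sub>R u)"
      by simp
    also have "\<dots> = l * (v \<bullet> v) - v \<bullet> f v + 2 * t * (u \<bullet> (l *\<^sub>R v - f v))
        + t\<^sup>2 * (l * (u \<bullet> u) - u \<bullet> f u)"
      using adj[of v u]
      by (simp add: linear_add[OF lin] linear_scale[OF lin] inner_add inner_diff
          algebra_simps power2_eq_square inner_commute)
    also have "\<dots> = 2 * t * (u \<bullet> u) + t\<^sup>2 * (l * (u \<bullet> u) - u \<bullet> f u)"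
      using v(2) unfolding uu by (simp add: l_def dot_square_norm)
    finally show ?thesis .
  qed
  define a where "a = u \<bullet> u"
  \<comment> \<open>An upper bound for the second-order coefficient; the step \<open>t = - a / c\<close> is short enough
    for the first-order term to win.\<close>
  define c where "c = \<bar>l * a - u \<bullet> f u\<bar> + 1"
  have "c > 0" "l * a - u \<bullet> f u \<le> c"
    by (auto simp: c_def)
  have "0 \<le> 2 * (- (a / c)) * a + (- (a / c))\<^sup>2 * (l * a - u \<bullet> f u)"
    using quad[of "- (a / c)"] by (simp add: a_def)
  also have "\<dots> \<le> 2 * (- (a / c)) * a + (- (a / c))\<^sup>2 * c"
    using \<open>l * a - u \<bullet> f u \<le> c\<close> by (intro add_left_mono mult_left_mono) auto
  also have "\<dots> = - (a\<^sup>2 / c)"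
    using \<open>c > 0\<close> by (simp add: field_simps power2_eq_square)
  finally have "a\<^sup>2 / c \<le> 0" by simp
  then have "a = 0"
    using \<open>c > 0\<close> by (simp add: divide_le_0_iff)
  then show ?thesis
    by (simp add: a_def u_def l_def)
qed

text \<open>
  Compactness of the sphere provides a maximiser, hence one eigenvector. As \<open>f\<close> is self-adjoint,
  its orthogonal complement in \<open>S\<close> is again invariant, and it has smaller dimension. Stating the
  result for an invariant subspace is what makes this induction possible.
\<close>

theorem self_adjoint_orthonormal_eigenbasis:
  fixes f :: "'a::euclidean_space \<Rightarrow> 'a"
  assumes lin: "linear f"
    and adj: "\<And>x y. f x \<bullet> y = x \<bullet> f y"
    and "subspace S" "f ` S \<subseteq> S"
  shows "\<exists>B \<subseteq> S. pairwise orthogonal B \<and> (\<forall>v\<in>B. norm v = 1 \<and> f v = (v \<bullet> f v) *\<^sub>R v)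
           \<and> span B = S"
  using assms(3,4)
proof (induction "dim S" arbitrary: S rule: less_induct)
  case less
  show ?case
  proof (cases "S = {0}")
    case True
    then show ?thesis by (intro exI[of _ "{}"]) auto
  next
    case False
    have cont: "continuous_on X (\<lambda>x. x \<bullet> f x)" for X
      using lin by (intro continuous_intros linear_continuous_on)
         (simp add: linear_conv_bounded_linear)
    obtain x where "x \<in> S" "x \<noteq> 0"
      using False subspace_0[OF less.prems(1)] by blast
    then have "(1 / norm x) *\<^sub>R x \<in> S \<inter> sphere 0 1"
      using less.prems(1) by (auto simp: subspace_scale)
    moreover have "compact (S \<inter> sphere 0 1)"
      using closed_subspace[OF less.prems(1)] by (simp add: closed_Int_compact)
    ultimately obtain v where "v \<in> S \<inter> sphere 0 1"
      and "\<And>x. x \<in> S \<inter> sphere 0 1 \<Longrightarrow> x \<bullet> f x \<le> v \<bullet> f v"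
      using continuous_attains_sup[OF _ _ cont] by (metis empty_iff)
    then have v: "v \<in> S" "norm v = 1" "\<And>x. x \<in> S \<Longrightarrow> norm x = 1 \<Longrightarrow> x \<bullet> f x \<le> v \<bullet> f v"
      by auto
    have ev: "f v = (v \<bullet> f v) *\<^sub>R v"
      by (rule self_adjoint_maximiser_eigenvector[OF lin adj less.prems v])
    define S' where "S' = S \<inter> {x. v \<bullet> x = 0}"
    have S': "subspace S'"
      unfolding S'_def using less.prems(1)
      by (auto simp: subspace_def inner_add_right)
    have "v \<bullet> f x = 0" if "v \<bullet> x = 0" for x
      using adj[of v x] ev that by (metis inner_scaleR_left mult_zero_right)
    then have inv: "f ` S' \<subseteq> S'"
      using less.prems by (auto simp: S'_def)
    have "v \<notin> S'"
      using v(2) by (auto simp: S'_def dot_square_norm)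
    have "S' \<subset> S"
      using \<open>v \<notin> S'\<close> v(1) unfolding S'_def by blast
    then have "span S' \<subset> span S"
      using less.prems(1) S' by (metis span_eq_iff)
    then have "dim S' < dim S"
      by (rule dim_psubset)
    from less.hyps[OF this S' inv] obtain B where B: "B \<subseteq> S'" "pairwise orthogonal B"
      "\<forall>v\<in>B. norm v = 1 \<and> f v = (v \<bullet> f v) *\<^sub>R v" "span B = S'"
      by blast
    have "span (insert v B) = S"
    proof
      show "span (insert v B) \<subseteq> S"
        using v(1) B(1) less.prems(1) by (intro span_minimal) (auto simp: S'_def)
      show "S \<subseteq> span (insert v B)"
      proof
        fix x assume "x \<in> S"
        then have "x - (v \<bullet> x) *\<^sub>R v \<in> span B"
          using B(4) v less.prems(1)
          by (auto simp: S'_def inner_diff dot_square_norm intro!: subspace_diff subspace_scale)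
        then show "x \<in> span (insert v B)"
          by (auto simp: span_insert)
      qed
    qed
    moreover have "pairwise orthogonal (insert v B)"
      using B(1,2) by (auto simp: pairwise_insert S'_def orthogonal_def inner_commute)
    ultimately show ?thesis
      using B(1,3) v(1,2) ev by (intro exI[of _ "insert v B"]) (auto simp: S'_def)
  qed
qed

section \<open>Orthonormal eigenbases and the pseudo-inverse\<close>

locale eigenbasis =
  fixes A :: "real^'n^'n" and B :: "(real^'n) set"
  assumes orthogonal_basis: "pairwise orthogonal B"
    and norm_basis: "v \<in> B \<Longrightarrow> norm v = 1"
    and eigenvector: "v \<in> B \<Longrightarrow> A *v v = (v \<bullet> (A *v v)) *\<^sub>R v"
    and span_basis: "span B = UNIV"
begin

definition ev :: "real^'n \<Rightarrow> real" where
  "ev v = v \<bullet> (A *v v)"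

lemma independent_basis: "independent B"
proof (rule pairwise_orthogonal_independent[OF orthogonal_basis])
  show "0 \<notin> B"
    using norm_basis[of 0] by auto
qed

lemma finite_basis: "finite B"
  using independent_basis by (rule independent_imp_finite)

lemma card_basis: "card B = CARD('n)"
  using dim_span_eq_card_independent[OF independent_basis] span_basis
  by (simp add: dim_UNIV)

lemma inner_basis: "u \<in> B \<Longrightarrow> v \<in> B \<Longrightarrow> u \<bullet> v = (if u = v then 1 else 0)"
  using orthogonal_basis norm_basis[of v]
  by (simp add: pairwise_def orthogonal_def dot_square_norm)

lemma expansion: "(\<Sum>v\<in>B. (v \<bullet> x) *\<^sub>R v) = x"
  using orthonormal_basis_expand[OF orthogonal_basis norm_basis _ finite_basis, of x]
  by (simp add: span_basis inner_commute[of x])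

lemma inner_basis_sum: "u \<in> B \<Longrightarrow> u \<bullet> (\<Sum>v\<in>B. c v *\<^sub>R v) = c u"
  using finite_basis by (simp add: inner_sum_right inner_basis if_distrib cong: if_cong)

lemma parseval: "x \<bullet> y = (\<Sum>v\<in>B. (v \<bullet> x) * (v \<bullet> y))"
proof -
  have "x \<bullet> y = (\<Sum>v\<in>B. (v \<bullet> x) *\<^sub>R v) \<bullet> y"
    by (simp add: expansion)
  then show ?thesis
    by (simp add: inner_sum_left)
qed

lemma eq_by_basis:
  assumes "\<And>v. v \<in> B \<Longrightarrow> v \<bullet> x = v \<bullet> y"
  shows "x = y"
proof -
  have "(\<Sum>v\<in>B. (v \<bullet> x) *\<^sub>R v) = (\<Sum>v\<in>B. (v \<bullet> y) *\<^sub>R v)"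
    by (intro sum.cong refl) (simp add: assms)
  then show ?thesis
    by (simp only: expansion)
qed

lemma inner_basis_mult:
  assumes "v \<in> B"
  shows "v \<bullet> (A *v x) = ev v * (v \<bullet> x)"
proof -
  have "A *v x = (\<Sum>u\<in>B. (u \<bullet> x) *\<^sub>R (A *v u))"
    by (subst expansion[of x, symmetric])
       (simp add: linear_sum[OF matrix_vector_mul_linear] matrix_vector_mult_scaleR)
  also have "\<dots> = (\<Sum>u\<in>B. ((u \<bullet> x) * ev u) *\<^sub>R u)"
    by (intro sum.cong refl) (metis eigenvector ev_def scaleR_scaleR)
  finally show ?thesis
    using assms by (simp add: inner_basis_sum mult.commute)
qed

end

lemma symmetric_matrix_eigenbasis:
  fixes A :: "real^'n^'n"
  assumes "\<And>x y. (A *v x) \<bullet> y = x \<bullet> (A *v y)"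
  obtains B where "eigenbasis A B"
  using self_adjoint_orthonormal_eigenbasis[OF matrix_vector_mul_linear assms, of UNIV]
  by (auto simp: eigenbasis_def)

text \<open>
  The Penrose conditions ask for symmetric matrices, whereas the spectral side produces
  self-adjoint maps; this is the bridge between the two.
\<close>

lemma self_adjoint_imp_transpose_eq:
  fixes A :: "real^'n^'n"
  assumes "\<And>x y. (A *v x) \<bullet> y = x \<bullet> (A *v y)"
  shows "transpose A = A"
proof -
  have "transpose A *v x = A *v x" for x
  proof (rule vector_eq_rdot[THEN iffD1], intro allI)
    fix y show "(transpose A *v x) \<bullet> y = (A *v x) \<bullet> y"
      using dot_lmul_matrix[of x A y] assms[of x y] by (simp add: transpose_matrix_vector)
  qed
  then show ?thesis
    by (simp add: matrix_eq)
qed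

text \<open>
  The symmetry conditions force \<open>A X = A Y\<close> and \<open>X A = Y A\<close>: both products are the orthogonal
  projections onto the range of \<open>A\<close> and of its transpose. Then \<open>X = X A X = Y A Y = Y\<close>.
\<close>

lemma penrose_conditions_unique:
  fixes A :: "real^'n^'m"
  assumes X: "A ** X ** A = A" "X ** A ** X = X"
    "transpose (A ** X) = A ** X" "transpose (X ** A) = X ** A"
  assumes Y: "A ** Y ** A = A" "Y ** A ** Y = Y"
    "transpose (A ** Y) = A ** Y" "transpose (Y ** A) = Y ** A"
  shows "X = Y"
proof -
  have "A ** X = (A ** Y) ** (A ** X)"
    by (simp add: matrix_mul_assoc Y(1))
  also have "\<dots> = transpose ((A ** X) ** (A ** Y))"
    by (subst matrix_transpose_mul) (simp only: X(3) Y(3))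
  also have "\<dots> = A ** Y"
    by (simp add: matrix_mul_assoc X(1) Y(3))
  finally have AX: "A ** X = A ** Y" .
  have "X ** A = (X ** A) ** (Y ** A)"
    by (metis matrix_mul_assoc Y(1))
  also have "\<dots> = transpose ((Y ** A) ** (X ** A))"
    by (subst matrix_transpose_mul) (simp only: X(4) Y(4))
  also have "\<dots> = Y ** A"
    by (metis matrix_mul_assoc X(1) Y(4))
  finally have XA: "X ** A = Y ** A" .
  have "X = X ** (A ** X)"
    by (simp add: matrix_mul_assoc X(2))
  also have "\<dots> = (Y ** A) ** Y"
    by (simp add: AX matrix_mul_assoc XA)
  finally show ?thesis
    by (simp add: Y(2))
qed

context eigenbasis
begin

text \<open>
  In an eigenbasis the pseudo-inverse inverts the nonzero eigenvalues and keeps the zero ones.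
  Since \<open>inverse 0 = 0\<close>, one formula covers both cases. The Penrose conditions are checked
  coordinate by coordinate, where they are identities between numbers.
\<close>

lemma inner_basis_pseudo_inverse:
  assumes "v \<in> B"
  shows "v \<bullet> (pseudo_inverse A *v x) = inverse (ev v) * (v \<bullet> x)"
proof -
  define X where "X = matrix (\<lambda>x. \<Sum>v\<in>B. (inverse (ev v) * (v \<bullet> x)) *\<^sub>R v)"
  have "linear (\<lambda>x. \<Sum>v\<in>B. (inverse (ev v) * (v \<bullet> x)) *\<^sub>R v)"
    by (rule linearI)
       (simp_all add: inner_add_right algebra_simps sum.distrib scaleR_sum_right)
  then have "X *v x = (\<Sum>v\<in>B. (inverse (ev v) * (v \<bullet> x)) *\<^sub>R v)" for x
    unfolding X_def by (simp add: matrix_works)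
  then have X: "v \<bullet> (X *v x) = inverse (ev v) * (v \<bullet> x)" if "v \<in> B" for v x
    using that by (simp add: inner_basis_sum)
  have eqI: "C = D" if "\<And>v x. v \<in> B \<Longrightarrow> v \<bullet> (C *v x) = v \<bullet> (D *v x)" for C D
    unfolding matrix_eq using that by (auto intro: eq_by_basis)
  have symI: "transpose C = C"
    if "\<And>v x. v \<in> B \<Longrightarrow> v \<bullet> (C *v x) = c v * (v \<bullet> x)" for C :: "real^'n^'n" and c
  proof (rule self_adjoint_imp_transpose_eq)
    fix x y
    show "(C *v x) \<bullet> y = x \<bullet> (C *v y)"
      unfolding parseval[of "C *v x" y] parseval[of x "C *v y"]
      by (intro sum.cong) (simp_all add: that)
  qed
  note simps = matrix_vector_mul_assoc[symmetric] inner_basis_mult X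
  have cancel: "ev v * (inverse (ev v) * (ev v * y)) = ev v * y"
    "inverse (ev v) * (ev v * (inverse (ev v) * y)) = inverse (ev v) * y" for v y
    by (cases "ev v = 0"; simp)+
  have penrose: "A ** X ** A = A" "X ** A ** X = X"
      "transpose (A ** X) = A ** X" "transpose (X ** A) = X ** A"
    subgoal by (rule eqI) (simp only: simps cancel)
    subgoal by (rule eqI) (simp only: simps cancel)
    subgoal by (rule symI[of _ "\<lambda>v. ev v * inverse (ev v)"]) (simp add: simps)
    subgoal by (rule symI[of _ "\<lambda>v. ev v * inverse (ev v)"]) (simp add: simps)
    done
  have "pseudo_inverse A = X"
    unfolding pseudo_inverse_def
  proof (rule the_equality)
    show "A ** X ** A = A \<and> X ** A ** X = X \<and>
      transpose (A ** X) = A ** X \<and> transpose (X ** A) = X ** A"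
      by (intro conjI penrose)
  next
    fix Y assume "A ** Y ** A = A \<and> Y ** A ** Y = Y \<and>
      transpose (A ** Y) = A ** Y \<and> transpose (Y ** A) = Y ** A"
    then show "Y = X"
      by (elim conjE) (rule penrose_conditions_unique[OF _ _ _ _ penrose])
  qed
  then show ?thesis
    using X assms by simp
qed

lemma inner_pseudo_inverse:
  "x \<bullet> (pseudo_inverse A *v y) = (\<Sum>v\<in>B. inverse (ev v) * (v \<bullet> x) * (v \<bullet> y))"
  unfolding parseval[of x "pseudo_inverse A *v y"]
  by (intro sum.cong) (simp_all add: inner_basis_pseudo_inverse)

end

section \<open>The Laplacian as a sum over edges\<close>

text \<open>
  A column of the oriented incidence matrix. The orientation is chosen arbitrarily; only
  expressions that are even in this vector occur, so the choice does not matter.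
\<close>

definition edge_vector :: "'n::finite set \<Rightarrow> real^'n" where
  "edge_vector e = (SOME d. \<exists>i j. i \<noteq> j \<and> e = {i, j} \<and> d = axis i 1 - axis j 1)"

lemma edge_vectorE:
  assumes "simple_graph E" "e \<in> E"
  obtains i j where "i \<noteq> j" "e = {i, j}" "edge_vector e = axis i 1 - axis j 1"
proof -
  have "\<exists>d :: real^'a. \<exists>i j. i \<noteq> j \<and> e = {i, j} \<and> d = axis i 1 - axis j 1"
    using assms by (fastforce simp: simple_graph_def)
  from someI_ex[OF this] show ?thesis
    unfolding edge_vector_def[symmetric] using that by blast
qed

lemma inner_axis_diff: "(axis i 1 - axis j 1) \<bullet> x = x $ i - x $ j" for x :: "real^'n"
  by (simp add: inner_diff_left inner_axis')

lemma edge_vector_components: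
  assumes "simple_graph E" "e \<in> E"
  shows "edge_vector e $ k * edge_vector e $ l =
    (if k = l then of_bool (k \<in> e) else - of_bool (e = {k, l}))"
  using assms by (rule edge_vectorE) (auto simp: axis_def doubleton_eq_iff)

lemma edge_value_power:
  assumes "simple_graph E" "e \<in> E"
  shows "edge_value (\<lambda>i j. \<bar>x $ i - x $ j\<bar>\<^sup>2) e = (edge_vector e \<bullet> x)\<^sup>2"
proof -
  obtain i j where "e = {i, j}" "edge_vector e = axis i 1 - axis j 1"
    using assms by (rule edge_vectorE)
  then show ?thesis
    by (subst \<open>e = {i, j}\<close>, subst edge_value_doubleton) (auto simp: inner_axis_diff power2_commute)
qed

lemma effective_reactance_eq:
  assumes "simple_graph E" "e \<in> E"
  shows "effective_reactance E b e =
    edge_vector e \<bullet> (pseudo_inverse (laplacian E b) *v edge_vector e)"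
proof -
  let ?P = "pseudo_inverse (laplacian E b)"
  obtain i j where "e = {i, j}" "edge_vector e = axis i 1 - axis j 1"
    using assms by (rule edge_vectorE)
  moreover have "(?P *v axis k 1) $ l = ?P $ l $ k" for k l
    by (simp add: matrix_vector_mul_component inner_axis)
  ultimately show ?thesis
    unfolding effective_reactance_def Let_def
    by (subst \<open>e = {i, j}\<close>, subst edge_value_doubleton)
       (auto simp: inner_axis_diff matrix_vector_mult_diff_distrib)
qed

text \<open>
  The factorisation \<open>L = \<Sum>\<^sub>e w\<^sub>e d\<^sub>e d\<^sub>e\<^sup>T\<close> through the incidence matrix, entry by entry.
\<close>

lemma laplacian_eq_sum:
  assumes "simple_graph E"
  shows "laplacian E w $ k $ l = (\<Sum>e\<in>E. w e * (edge_vector e $ k * edge_vector e $ l))"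
proof -
  have "finite E" by simp
  have "{k} \<notin> E"
    using assms by (auto simp: simple_graph_def doubleton_eq_iff)
  have "(\<Sum>e\<in>E. w e * (edge_vector e $ k * edge_vector e $ l)) =
      (\<Sum>e\<in>E. if k = l then if k \<in> e then w e else 0 else if e = {k, l} then - w e else 0)"
    by (intro sum.cong) (auto simp: edge_vector_components[OF assms])
  also have "\<dots> = laplacian E w $ k $ l"
  proof (cases "k = l")
    case True
    then show ?thesis
      using \<open>{k} \<notin> E\<close> \<open>finite E\<close>
      by (simp add: laplacian_def weighted_degree_def weighted_adjacency_def sum.inter_filter)
  next
    case False
    then show ?thesis
      using \<open>finite E\<close>
      by (simp add: laplacian_def weighted_degree_def weighted_adjacency_def)
  qed
  finally show ?thesis ..
qed

lemma inner_laplacian: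
  assumes "simple_graph E"
  shows "x \<bullet> (laplacian E w *v y) =
    (\<Sum>e\<in>E. w e * (edge_vector e \<bullet> x) * (edge_vector e \<bullet> y))"
proof -
  have "x \<bullet> (laplacian E w *v y) = (\<Sum>k\<in>UNIV. \<Sum>l\<in>UNIV. \<Sum>e\<in>E.
      w e * (edge_vector e $ k * x $ k) * (edge_vector e $ l * y $ l))"
    by (simp add: inner_vec_def matrix_vector_mult_def laplacian_eq_sum[OF assms]
        sum_distrib_left sum_distrib_right mult_ac)
  also have "\<dots> = (\<Sum>e\<in>E. \<Sum>k\<in>UNIV. \<Sum>l\<in>UNIV.
      w e * (edge_vector e $ k * x $ k) * (edge_vector e $ l * y $ l))"
    by (simp only: sum.swap[of _ E])
  also have "\<dots> = (\<Sum>e\<in>E. w e * (edge_vector e \<bullet> x) * (edge_vector e \<bullet> y))"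
    by (simp add: inner_vec_def sum_distrib_left sum_distrib_right mult_ac)
  finally show ?thesis .
qed

lemma laplacian_self_adjoint:
  assumes "simple_graph E"
  shows "(laplacian E w *v x) \<bullet> y = x \<bullet> (laplacian E w *v y)"
  by (simp add: inner_laplacian[OF assms] inner_commute[of _ y] mult_ac)

lemma connected_constant:
  fixes x :: "real^'n"
  assumes "simple_graph E" "graph_connected E" "\<And>e. e \<in> E \<Longrightarrow> edge_vector e \<bullet> x = 0"
  shows "x $ i = x $ j"
proof -
  have "(i, j) \<in> {(u, v). {u, v} \<in> E}\<^sup>*"
    using assms(2) by (simp add: graph_connected_def)
  then show ?thesis
  proof induction
    case (step k l)
    then have "{k, l} \<in> E" by simp
    with assms(1) obtain i j where "{k, l} = {i, j}" "edge_vector {k, l} = axis i 1 - axis j 1"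
      by (rule edge_vectorE)
    then have "x $ k = x $ l"
      using assms(3)[OF \<open>{k, l} \<in> E\<close>] by (auto simp: inner_axis_diff doubleton_eq_iff)
    then show ?case using step by simp
  qed simp
qed

text \<open>
  A connected graph with positive weights, together with an orthonormal eigenbasis of its
  Laplacian.
\<close>

locale network =
  fixes E :: "'n::finite set set" and b :: "'n set \<Rightarrow> real" and B :: "(real^'n) set"
  assumes simple: "simple_graph E" and conn: "graph_connected E"
    and weight_pos: "e \<in> E \<Longrightarrow> b e > 0"
    and basis: "eigenbasis (laplacian E b) B"
begin

sublocale eigenbasis "laplacian E b" B
  by (rule basis)

lemma ev_eq: "ev v = (\<Sum>e\<in>E. b e * (edge_vector e \<bullet> v)\<^sup>2)"
  by (simp add: ev_def inner_laplacian[OF simple] power2_eq_square mult_ac)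

lemma ev_nonneg: "ev v \<ge> 0"
  unfolding ev_eq using weight_pos by (intro sum_nonneg) (simp add: less_imp_le)

text \<open>
  A vector in the kernel of the Laplacian has equal entries at the ends of every edge, since its
  quadratic form is a sum of nonnegative terms. Hence the edge differences \<open>d\<^sub>e \<bullet> \<theta>\<close> do not see
  the zero mode, in which the phase angles perform an unbounded random motion.
\<close>

lemma kernel_edge_vector:
  assumes "ev v = 0" "e \<in> E"
  shows "edge_vector e \<bullet> v = 0"
proof -
  have "b e * (edge_vector e \<bullet> v)\<^sup>2 = 0"
    using assms weight_pos unfolding ev_eq
    by (subst (asm) sum_nonneg_eq_0_iff) (auto simp: less_imp_le)
  then show ?thesis
    using weight_pos[OF assms(2)] by simp
qed

text \<open>
  At least one basis vector lies in the kernel because the Laplacian annihilates the all-ones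
  vector; at most one does because on a connected graph all kernel vectors are constant, and two
  nonzero constant vectors are not orthogonal.
\<close>

lemma card_kernel: "card {v\<in>B. ev v = 0} = 1"
proof -
  have const: "x = (x $ undefined) *\<^sub>R 1" if "ev x = 0" for x
    using connected_constant[OF simple conn kernel_edge_vector[OF that], of _ undefined]
    by (auto simp: vec_eq_iff)
  have "\<exists>v. v \<in> B \<and> ev v = 0"
  proof (rule ccontr)
    assume none: "\<nexists>v. v \<in> B \<and> ev v = 0"
    have "edge_vector e \<bullet> 1 = 0" if "e \<in> E" for e
      using simple that by (rule edge_vectorE) (simp add: inner_axis_diff)
    then have "v \<bullet> (laplacian E b *v 1) = 0" for v
      by (simp add: inner_laplacian[OF simple])
    then have "v \<bullet> 1 = v \<bullet> 0" if "v \<in> B" for v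
      using none that inner_basis_mult[of v 1] by auto
    then have "(1 :: real^'n) = 0"
      by (rule eq_by_basis)
    then show False by simp
  qed
  then obtain v where v: "v \<in> B" "ev v = 0" by blast
  have "u = v" if "u \<in> B" "ev u = 0" for u
  proof (rule ccontr)
    assume "u \<noteq> v"
    then have "u \<bullet> v = 0"
      using that v by (simp add: inner_basis)
    then have "(u $ undefined) *\<^sub>R 1 \<bullet> ((v $ undefined) *\<^sub>R 1 :: real^'n) = 0"
      using const that v by metis
    then have "u $ undefined = 0 \<or> v $ undefined = 0"
      by auto
    then have "u = 0 \<or> v = 0"
      using const[OF that(2)] const[OF v(2)] by (metis scaleR_zero_left)
    then show False
      using norm_basis[OF that(1)] norm_basis[OF v(1)] by auto
  qed
  with v have "{v\<in>B. ev v = 0} = {v}" by blast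
  then show ?thesis by simp
qed

lemma effective_reactance_sum:
  assumes "e \<in> E"
  shows "effective_reactance E b e = (\<Sum>v\<in>B. inverse (ev v) * (edge_vector e \<bullet> v)\<^sup>2)"
  using simple assms
  by (simp add: effective_reactance_eq inner_pseudo_inverse power2_eq_square mult_ac inner_commute)

text \<open>
  Foster's theorem. The sum is the trace of \<open>L\<^sup>\<dagger> L\<close>: each eigenvector with a nonzero eigenvalue
  contributes \<open>1\<close>, and only one eigenvalue is zero.
\<close>

theorem foster: "(\<Sum>e\<in>E. effective_reactance E b e * b e) = real CARD('n) - 1"
proof -
  have "(\<Sum>e\<in>E. effective_reactance E b e * b e) =
      (\<Sum>e\<in>E. \<Sum>v\<in>B. inverse (ev v) * (b e * (edge_vector e \<bullet> v)\<^sup>2))"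
    by (simp add: effective_reactance_sum sum_distrib_right sum_distrib_left mult_ac)
  also have "\<dots> = (\<Sum>v\<in>B. inverse (ev v) * ev v)"
    unfolding ev_eq by (subst sum.swap) (simp add: sum_distrib_left)
  also have "\<dots> = (\<Sum>v\<in>B. if ev v \<noteq> 0 then 1 else 0)"
    by (intro sum.cong) auto
  also have "\<dots> = real (card {v\<in>B. ev v \<noteq> 0})"
    using finite_basis by (simp add: sum.inter_filter[symmetric])
  also have "{v\<in>B. ev v \<noteq> 0} = B - {v\<in>B. ev v = 0}"
    by blast
  also have "real (card \<dots>) = real CARD('n) - 1"
    using finite_basis card_kernel by (subst card_Diff_subset) (auto simp: card_basis of_nat_diff)
  finally show ?thesis .
qed

end

section \<open>The impulse response of a damped oscillator\<close>

text \<open>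
  The solution with unit initial velocity of the oscillator that remains after the factor
  \<open>exp (- a t)\<close> has been split off: trigonometric, linear or hyperbolic according to the sign of
  \<open>k\<close>. The hypothesis \<open>k > - a\<^sup>2\<close> says exactly that the exponential factor dominates the
  hyperbolic growth.
\<close>

lemma damped_wave_exists:
  fixes a k :: real
  assumes "a > 0" "k > - a\<^sup>2"
  obtains S C where "\<And>t. (S has_real_derivative C t) (at t)"
    "\<And>t. (C has_real_derivative - k * S t) (at t)" "S 0 = 0" "C 0 = 1"
    "((\<lambda>t. exp (- a * t) * S t) \<longlongrightarrow> 0) at_top" "((\<lambda>t. exp (- a * t) * C t) \<longlongrightarrow> 0) at_top"
proof -
  have decay: "((\<lambda>t. exp (- c * t)) \<longlongrightarrow> 0) at_top" if "c > 0" for c :: real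
    using that by real_asymp
  consider "k > 0" | "k = 0" | "k < 0" by linarith
  then show ?thesis
  proof cases
    case 1
    define m where "m = sqrt k"
    have m: "m > 0" "m * m = k"
      using 1 by (auto simp: m_def)
    show ?thesis
    proof (rule that[of "\<lambda>t. sin (m * t) / m" "\<lambda>t. cos (m * t)"])
      show "((\<lambda>t. exp (- a * t) * (sin (m * t) / m)) \<longlongrightarrow> 0) at_top"
      proof (rule Lim_null_comparison)
        show "\<forall>\<^sub>F t in at_top. norm (exp (- a * t) * (sin (m * t) / m)) \<le> exp (- a * t) / m"
          using m by (intro always_eventually allI) (simp add: abs_mult divide_right_mono)
        show "((\<lambda>t. exp (- a * t) / m) \<longlongrightarrow> 0) at_top"
          using tendsto_divide[OF decay[OF assms(1)] tendsto_const[of m]] m by simp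
      qed
      show "((\<lambda>t. exp (- a * t) * cos (m * t)) \<longlongrightarrow> 0) at_top"
        by (rule Lim_null_comparison[OF _ decay[OF assms(1)]])
           (auto simp: abs_mult intro!: always_eventually)
    qed (use m in \<open>auto intro!: derivative_eq_intros simp: field_simps\<close>)
  next
    case 2
    show ?thesis
    proof (rule that[of "\<lambda>t. t" "\<lambda>t. 1"])
      show "((\<lambda>t. exp (- a * t) * t) \<longlongrightarrow> 0) at_top"
        using assms(1) by real_asymp
      show "((\<lambda>t. exp (- a * t) * 1) \<longlongrightarrow> 0) at_top"
        using decay[OF assms(1)] by simp
    qed (use 2 in \<open>auto intro!: derivative_eq_intros\<close>)
  next
    case 3
    define m where "m = sqrt (- k)"
    have m: "m > 0" "k = - (m * m)"
      using 3 by (auto simp: m_def)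
    have "m < a"
      using assms real_sqrt_less_mono[of "- k" "a\<^sup>2"] by (simp add: m_def)
    have d1: "((\<lambda>t. exp (- (a - m) * t)) \<longlongrightarrow> 0) at_top"
      and d2: "((\<lambda>t. exp (- (a + m) * t)) \<longlongrightarrow> 0) at_top"
      using \<open>m < a\<close> m assms(1) by (intro decay; simp)+
    show ?thesis
    proof (rule that[of "\<lambda>t. (exp (m * t) - exp (- m * t)) / (2 * m)"
          "\<lambda>t. (exp (m * t) + exp (- m * t)) / 2"])
      have e: "exp (- a * t) * exp (m * t) = exp (- (a - m) * t)"
        "exp (- a * t) * exp (- m * t) = exp (- (a + m) * t)" for t
        by (simp_all add: mult_exp_exp algebra_simps)
      have "((\<lambda>t. (exp (- (a - m) * t) - exp (- (a + m) * t)) / (2 * m)) \<longlongrightarrow> (0 - 0) / (2 * m)) at_top"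
        using m by (intro tendsto_intros d1 d2) auto
      then show "((\<lambda>t. exp (- a * t) * ((exp (m * t) - exp (- m * t)) / (2 * m))) \<longlongrightarrow> 0) at_top"
        by (simp only: e[symmetric]) (simp add: algebra_simps)
      have "((\<lambda>t. (exp (- (a - m) * t) + exp (- (a + m) * t)) / 2) \<longlongrightarrow> (0 + 0) / 2) at_top"
        by (intro tendsto_intros d1 d2) auto
      then show "((\<lambda>t. exp (- a * t) * ((exp (m * t) + exp (- m * t)) / 2)) \<longlongrightarrow> 0) at_top"
        by (simp only: e[symmetric]) (simp add: algebra_simps)
    qed (use m in \<open>auto intro!: derivative_eq_intros simp: field_simps\<close>)
  qed
qed

definition impulse_response :: "real \<Rightarrow> real \<Rightarrow> (real \<Rightarrow> real) \<Rightarrow> (real \<Rightarrow> real) \<Rightarrow> bool" where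
  "impulse_response \<beta> l h h' \<longleftrightarrow>
     (\<forall>t. (h has_real_derivative h' t) (at t)) \<and>
     (\<forall>t. (h' has_real_derivative - \<beta> * h' t - l * h t) (at t)) \<and>
     h 0 = 0 \<and> h' 0 = 1 \<and> (h \<longlongrightarrow> 0) at_top \<and> (h' \<longlongrightarrow> 0) at_top"

lemma impulse_response_exists:
  fixes \<beta> l :: real
  assumes "\<beta> > 0" "l > 0"
  shows "\<exists>h h'. impulse_response \<beta> l h h'"
proof -
  define a where "a = \<beta> / 2"
  have \<beta>: "\<beta> = 2 * a" by (simp add: a_def)
  have "a > 0" using assms by (simp add: a_def)
  moreover have "l - a\<^sup>2 > - a\<^sup>2" using assms by simp
  ultimately obtain S C where SC: "\<And>t. (S has_real_derivative C t) (at t)"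
    "\<And>t. (C has_real_derivative - (l - a\<^sup>2) * S t) (at t)" "S 0 = 0" "C 0 = 1"
    "((\<lambda>t. exp (- a * t) * S t) \<longlongrightarrow> 0) at_top" "((\<lambda>t. exp (- a * t) * C t) \<longlongrightarrow> 0) at_top"
    by (rule damped_wave_exists) blast
  define h where "h = (\<lambda>t. exp (- a * t) * S t)"
  define h' where "h' = (\<lambda>t. exp (- a * t) * C t - a * (exp (- a * t) * S t))"
  have "(h has_real_derivative h' t) (at t)" for t
    unfolding h_def h'_def by (auto intro!: derivative_eq_intros SC simp: algebra_simps)
  moreover have "(h' has_real_derivative - \<beta> * h' t - l * h t) (at t)" for t
    unfolding h'_def h_def \<beta>
    by (auto intro!: derivative_eq_intros SC simp: algebra_simps power2_eq_square)
  moreover have "(h \<longlongrightarrow> 0) at_top"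
    unfolding h_def by (rule SC)
  moreover have "(h' \<longlongrightarrow> 0 - a * 0) at_top"
    unfolding h'_def by (intro tendsto_intros SC)
  ultimately show ?thesis
    unfolding impulse_response_def
    using SC(3,4) by (intro exI[of _ h] exI[of _ h']) (auto simp: h_def h'_def)
qed

text \<open>
  The energy \<open>\<integral> h\<^sup>2\<close> comes from a Lyapunov function rather than from the explicit solution: the
  quadratic form in \<open>(h, h')\<close> below has derivative \<open>- h\<^sup>2\<close> along the flow. Its value at the
  initial state \<open>(0, 1)\<close> is \<open>1 / (2 \<beta> l)\<close>, and it tends to \<open>0\<close>.
\<close>

lemma impulse_response_energy:
  assumes h: "impulse_response \<beta> l h h'" and pos: "\<beta> > 0" "l > 0"
  shows "((\<lambda>t. integral {0..t} (\<lambda>s. (h s)\<^sup>2)) \<longlongrightarrow> 1 / (2 * \<beta> * l)) at_top"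
proof -
  have d: "\<And>t. (h has_real_derivative h' t) (at t)"
    "\<And>t. (h' has_real_derivative - \<beta> * h' t - l * h t) (at t)"
    using h by (auto simp: impulse_response_def)
  define F where "F = (\<lambda>t. - ((\<beta> / l + 1 / \<beta>) / 2 * (h t * h t) + 1 / l * (h t * h' t)
      + 1 / (2 * \<beta> * l) * (h' t * h' t)))"
  have F: "(F has_real_derivative (h t)\<^sup>2) (at t)" for t
    unfolding F_def using pos
    by (auto intro!: derivative_eq_intros d simp: field_simps power2_eq_square)
  have "integral {0..t} (\<lambda>s. (h s)\<^sup>2) = F t - F 0" if "t \<ge> 0" for t
    using that F by (intro integral_unique fundamental_theorem_of_calculus)
      (auto simp: has_real_derivative_iff_has_vector_derivative[symmetric]
         intro: DERIV_subset)
  then have "\<forall>\<^sub>F t in at_top. integral {0..t} (\<lambda>s. (h s)\<^sup>2) = F t + 1 / (2 * \<beta> * l)"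
    using h by (intro eventually_mono[OF eventually_ge_at_top[of 0]])
      (simp add: F_def impulse_response_def)
  moreover have "((\<lambda>t. F t + 1 / (2 * \<beta> * l)) \<longlongrightarrow>
      - ((\<beta> / l + 1 / \<beta>) / 2 * (0 * 0) + 1 / l * (0 * 0) + 1 / (2 * \<beta> * l) * (0 * 0))
        + 1 / (2 * \<beta> * l)) at_top"
    using h unfolding F_def impulse_response_def by (intro tendsto_intros) auto
  ultimately show ?thesis
    using filterlim_cong by force
qed

definition vector_impulse_response ::
    "real \<Rightarrow> real^'n^'n \<Rightarrow> real^'n \<Rightarrow> (real \<Rightarrow> real^'n) \<Rightarrow> (real \<Rightarrow> real^'n) \<Rightarrow> bool" where
  "vector_impulse_response \<beta> A d H H' \<longleftrightarrow>
     (\<forall>t. (H has_vector_derivative H' t) (at t)) \<and>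
     (\<forall>t. (H' has_vector_derivative - \<beta> *\<^sub>R H' t - A *v H t) (at t)) \<and>
     H 0 = 0 \<and> H' 0 = d \<and> (H \<longlongrightarrow> 0) at_top \<and> (H' \<longlongrightarrow> 0) at_top"

text \<open>
  The modes are decoupled in the eigenbasis, so the response is the superposition of scalar ones,
  and by orthogonality its energy is the sum of the scalar energies weighted by \<open>(v \<bullet> d)\<^sup>2\<close>. With
  \<open>1 / (2 \<beta> \<lambda>)\<close> for the mode of eigenvalue \<open>\<lambda>\<close>, this sum is the quadratic form of the
  pseudo-inverse. The zero mode has no decaying response, hence the condition that \<open>d\<close> is
  orthogonal to the kernel.
\<close>

lemma (in eigenbasis) vector_impulse_response_exists:
  assumes "\<beta> > 0" and nonneg: "\<And>v. v \<in> B \<Longrightarrow> ev v \<ge> 0"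
    and ker: "\<And>v. v \<in> B \<Longrightarrow> ev v = 0 \<Longrightarrow> v \<bullet> d = 0"
  obtains H H' where "vector_impulse_response \<beta> A d H H'"
    "((\<lambda>t. integral {0..t} (\<lambda>s. (norm (H s))\<^sup>2)) \<longlongrightarrow>
       d \<bullet> (pseudo_inverse A *v d) / (2 * \<beta>)) at_top"
proof -
  define B' where "B' = {v\<in>B. ev v > 0}"
  have B': "finite B'" "B' \<subseteq> B" "\<And>v. v \<in> B' \<Longrightarrow> ev v > 0"
    using finite_basis by (auto simp: B'_def)
  have zero: "v \<bullet> d = 0" if "v \<in> B - B'" for v
    using that ker nonneg[of v] by (force simp: B'_def)
  have "\<forall>v. \<exists>p. v \<in> B' \<longrightarrow> impulse_response \<beta> (ev v) (fst p) (snd p)"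
    using impulse_response_exists[OF \<open>\<beta> > 0\<close> B'(3)] by (metis fst_conv snd_conv)
  then obtain p where p: "\<And>v. v \<in> B' \<Longrightarrow> impulse_response \<beta> (ev v) (fst (p v)) (snd (p v))"
    by metis
  define h where "h v = fst (p v)" for v
  define h' where "h' v = snd (p v)" for v
  have h: "impulse_response \<beta> (ev v) (h v) (h' v)" if "v \<in> B'" for v
    using p[OF that] by (simp add: h_def h'_def)
  define H where "H t = (\<Sum>v\<in>B'. ((v \<bullet> d) * h v t) *\<^sub>R v)" for t
  define H' where "H' t = (\<Sum>v\<in>B'. ((v \<bullet> d) * h' v t) *\<^sub>R v)" for t
  have AH: "A *v H t = (\<Sum>v\<in>B'. ((v \<bullet> d) * (ev v * h v t)) *\<^sub>R v)" for t
  proof -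
    have "A *v H t = (\<Sum>v\<in>B'. ((v \<bullet> d) * h v t) *\<^sub>R (A *v v))"
      unfolding H_def
      by (simp add: linear_sum[OF matrix_vector_mul_linear] matrix_vector_mult_scaleR)
    also have "\<dots> = (\<Sum>v\<in>B'. ((v \<bullet> d) * (ev v * h v t)) *\<^sub>R v)"
      using B'(2) by (intro sum.cong refl) (subst eigenvector, auto simp: ev_def)
    finally show ?thesis .
  qed
  have "(H has_vector_derivative H' t) (at t)" for t
    unfolding H_def H'_def
  proof (rule has_vector_derivative_sum)
    fix v assume "v \<in> B'"
    then have "((\<lambda>t. (v \<bullet> d) * h v t) has_real_derivative (v \<bullet> d) * h' v t) (at t)"
      using h by (intro DERIV_cmult) (auto simp: impulse_response_def)
    then show "((\<lambda>t. ((v \<bullet> d) * h v t) *\<^sub>R v) has_vector_derivative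
        ((v \<bullet> d) * h' v t) *\<^sub>R v) (at t)"
      using has_vector_derivative_scaleR[OF _ has_vector_derivative_const[of v]] by fastforce
  qed
  moreover have "(H' has_vector_derivative - \<beta> *\<^sub>R H' t - A *v H t) (at t)" for t
  proof -
    have "(H' has_vector_derivative
        (\<Sum>v\<in>B'. ((v \<bullet> d) * (- \<beta> * h' v t - ev v * h v t)) *\<^sub>R v)) (at t)"
      unfolding H'_def
    proof (rule has_vector_derivative_sum)
      fix v assume "v \<in> B'"
      then have "((\<lambda>t. (v \<bullet> d) * h' v t) has_real_derivative
          (v \<bullet> d) * (- \<beta> * h' v t - ev v * h v t)) (at t)"
        using h by (intro DERIV_cmult) (auto simp: impulse_response_def)
      then show "((\<lambda>t. ((v \<bullet> d) * h' v t) *\<^sub>R v) has_vector_derivative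
          ((v \<bullet> d) * (- \<beta> * h' v t - ev v * h v t)) *\<^sub>R v) (at t)"
        using has_vector_derivative_scaleR[OF _ has_vector_derivative_const[of v]] by fastforce
    qed
    also have "(\<Sum>v\<in>B'. ((v \<bullet> d) * (- \<beta> * h' v t - ev v * h v t)) *\<^sub>R v) =
        - \<beta> *\<^sub>R H' t - A *v H t"
      unfolding AH H'_def
      by (simp add: scaleR_sum_right sum_subtractf[symmetric] sum_negf[symmetric] algebra_simps)
    finally show ?thesis .
  qed
  moreover have "H 0 = 0"
    unfolding H_def using h by (intro sum.neutral) (auto simp: impulse_response_def)
  moreover have "H' 0 = d"
  proof -
    have "H' 0 = (\<Sum>v\<in>B'. (v \<bullet> d) *\<^sub>R v)"
      unfolding H'_def using h by (intro sum.cong) (auto simp: impulse_response_def)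
    also have "\<dots> = (\<Sum>v\<in>B. (v \<bullet> d) *\<^sub>R v)"
      using zero B' finite_basis by (intro sum.mono_neutral_left) auto
    finally show ?thesis by (simp add: expansion)
  qed
  moreover have "(H \<longlongrightarrow> (\<Sum>v\<in>B'. ((v \<bullet> d) * 0) *\<^sub>R v)) at_top"
    unfolding H_def using h by (intro tendsto_intros) (auto simp: impulse_response_def)
  moreover have "(H' \<longlongrightarrow> (\<Sum>v\<in>B'. ((v \<bullet> d) * 0) *\<^sub>R v)) at_top"
    unfolding H'_def using h by (intro tendsto_intros) (auto simp: impulse_response_def)
  ultimately have "vector_impulse_response \<beta> A d H H'"
    by (simp add: vector_impulse_response_def)
  moreover have "((\<lambda>t. integral {0..t} (\<lambda>s. (norm (H s))\<^sup>2)) \<longlongrightarrow>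
       d \<bullet> (pseudo_inverse A *v d) / (2 * \<beta>)) at_top"
  proof -
    have normH: "(norm (H s))\<^sup>2 = (\<Sum>v\<in>B'. (v \<bullet> d)\<^sup>2 * (h v s)\<^sup>2)" for s
    proof -
      have "H s = (\<Sum>v\<in>B. (if v \<in> B' then (v \<bullet> d) * h v s else 0) *\<^sub>R v)"
        unfolding H_def using B' finite_basis by (intro sum.mono_neutral_cong_left) auto
      then have vH: "v \<bullet> H s = (if v \<in> B' then (v \<bullet> d) * h v s else 0)" if "v \<in> B" for v
        using that by (simp add: inner_basis_sum)
      have "(norm (H s))\<^sup>2 = (\<Sum>v\<in>B. (v \<bullet> H s) * (v \<bullet> H s))"
        unfolding power2_norm_eq_inner by (rule parseval)
      also have "\<dots> = (\<Sum>v\<in>B'. (v \<bullet> d)\<^sup>2 * (h v s)\<^sup>2)"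
        using B' finite_basis
        by (intro sum.mono_neutral_cong_right) (auto simp: vH power2_eq_square mult_ac)
      finally show ?thesis .
    qed
    have "continuous_on X (h v)" if "v \<in> B'" for v X
      using h[OF that] unfolding impulse_response_def
      by (intro DERIV_continuous_on) (auto intro: DERIV_subset)
    then have "integral {0..t} (\<lambda>s. (norm (H s))\<^sup>2) =
        (\<Sum>v\<in>B'. (v \<bullet> d)\<^sup>2 * integral {0..t} (\<lambda>s. (h v s)\<^sup>2))" for t
      unfolding normH using B'(1)
      by (subst integral_sum) (auto intro!: integrable_continuous_real continuous_intros)
    moreover have "((\<lambda>t. \<Sum>v\<in>B'. (v \<bullet> d)\<^sup>2 * integral {0..t} (\<lambda>s. (h v s)\<^sup>2)) \<longlongrightarrow>
        (\<Sum>v\<in>B'. (v \<bullet> d)\<^sup>2 * (1 / (2 * \<beta> * ev v)))) at_top"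
      using impulse_response_energy[OF h \<open>\<beta> > 0\<close> B'(3)] by (intro tendsto_intros)
    moreover have "(\<Sum>v\<in>B'. (v \<bullet> d)\<^sup>2 * (1 / (2 * \<beta> * ev v))) =
        d \<bullet> (pseudo_inverse A *v d) / (2 * \<beta>)"
      unfolding inner_pseudo_inverse sum_divide_distrib using B' zero finite_basis
      by (intro sum.mono_neutral_cong_left) (auto simp: field_simps power2_eq_square)
    ultimately show ?thesis
      by simp
  qed
  ultimately show ?thesis
    by (rule that)
qed

text \<open>
  Let \<open>u = \<omega> - W\<close>, which unlike \<open>\<omega>\<close> is differentiable. Pairing the state \<open>(\<theta>, u)\<close> at time
  \<open>s\<close> with the time-reversed response gives a function of \<open>s\<close> whose derivative is
  \<open>H' (t - s) \<bullet> W s\<close>, because the homogeneous terms cancel by the symmetry of \<open>A\<close>. Its values at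
  \<open>s = t\<close> and \<open>s = 0\<close> are \<open>d \<bullet> \<theta> t\<close> and the response to the initial state. The noise enters
  only through its integral \<open>W\<close>, so this is an identity for each path.
\<close>

lemma variation_of_constants:
  fixes A :: "real^'n^'n" and \<theta> \<omega> W H H' :: "real \<Rightarrow> real^'n"
  assumes sym: "\<And>x y. (A *v x) \<bullet> y = x \<bullet> (A *v y)"
    and H: "vector_impulse_response \<beta> A d H H'"
    and W: "continuous_on {0..} W"
    and sol1: "\<And>t. t \<ge> 0 \<Longrightarrow> (\<omega> has_integral (\<theta> t - \<theta> 0)) {0..t}"
    and sol2: "\<And>t. t \<ge> 0 \<Longrightarrow>
      ((\<lambda>s. - (A *v \<theta> s) - \<beta> *\<^sub>R \<omega> s) has_integral (\<omega> t - \<omega> 0 - W t)) {0..t}"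
    and t: "t \<ge> 0"
  shows "d \<bullet> \<theta> t = H t \<bullet> \<omega> 0 + (H' t + \<beta> *\<^sub>R H t) \<bullet> \<theta> 0 +
    integral {0..t} (\<lambda>s. H' (t - s) \<bullet> W s)"
proof -
  define u where "u s = \<omega> s - W s" for s
  let ?f = "\<lambda>s. - (A *v \<theta> s) - \<beta> *\<^sub>R \<omega> s"
  have "W 0 = 0"
    using integral_unique[OF sol2[of 0]] by simp
  have \<theta>: "\<theta> s = \<theta> 0 + integral {0..s} \<omega>" if "s \<ge> 0" for s
    using sol1[OF that] by (simp add: integral_unique)
  have u: "u s = \<omega> 0 + integral {0..s} ?f" if "s \<ge> 0" for s
    using sol2[OF that] by (simp add: integral_unique u_def)
  have "continuous_on {0..t} (\<lambda>s. \<theta> 0 + integral {0..s} \<omega>)"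
    using sol1[OF t] by (intro continuous_intros indefinite_integral_continuous_1) blast
  then have cont\<theta>: "continuous_on {0..t} \<theta>"
    by (subst continuous_on_cong[OF refl \<theta>]) auto
  have "continuous_on {0..t} (\<lambda>s. \<omega> 0 + integral {0..s} ?f)"
    using sol2[OF t] by (intro continuous_intros indefinite_integral_continuous_1) blast
  then have "continuous_on {0..t} u"
    by (subst continuous_on_cong[OF refl u]) auto
  then have "continuous_on {0..t} (\<lambda>s. u s + W s)"
    by (intro continuous_intros continuous_on_subset[OF W]) auto
  then have cont\<omega>: "continuous_on {0..t} \<omega>"
    by (simp add: u_def)
  have d\<theta>: "(\<theta> has_vector_derivative \<omega> s) (at s within {0..t})" if "s \<in> {0..t}" for s
  proof -
    have "((\<lambda>s. \<theta> 0 + integral {0..s} \<omega>) has_vector_derivative \<omega> s) (at s within {0..t})"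
      using has_vector_derivative_add[OF has_vector_derivative_const
          integral_has_vector_derivative[OF cont\<omega> that]] by simp
    then show ?thesis
      by (rule has_vector_derivative_transform[OF that, rotated]) (simp add: \<theta>[symmetric])
  qed
  have du: "(u has_vector_derivative ?f s) (at s within {0..t})" if "s \<in> {0..t}" for s
  proof -
    have "continuous_on {0..t} (\<lambda>s. A *v \<theta> s)"
      by (rule linear_continuous_on_compose[OF cont\<theta> matrix_vector_mul_linear])
    then have "continuous_on {0..t} ?f"
      by (intro continuous_on_diff continuous_on_minus continuous_on_scaleR
          continuous_on_const cont\<omega>)
    from has_vector_derivative_add[OF has_vector_derivative_const
        integral_has_vector_derivative[OF this that]]
    have "((\<lambda>s. \<omega> 0 + integral {0..s} ?f) has_vector_derivative ?f s) (at s within {0..t})"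
      by simp
    then show ?thesis
      by (rule has_vector_derivative_transform[OF that, rotated]) (simp add: u[symmetric])
  qed
  have reverse: "((\<lambda>s. G (t - s)) has_vector_derivative - G' (t - s)) (at s within {0..t})"
    if "\<And>s. (G has_vector_derivative G' s) (at s)" for G G' :: "real \<Rightarrow> real^'n" and s
  proof -
    have "((\<lambda>s. t - s) has_vector_derivative - 1) (at s)"
      by (auto intro!: derivative_eq_intros)
    from vector_diff_chain_at[OF this that] show ?thesis
      by (simp add: o_def has_vector_derivative_at_within)
  qed
  define K where "K s = H' s + \<beta> *\<^sub>R H s" for s
  have dH: "((\<lambda>s. H (t - s)) has_vector_derivative - H' (t - s)) (at s within {0..t})" for s
    using H by (intro reverse) (auto simp: vector_impulse_response_def)
  have dK: "((\<lambda>s. K (t - s)) has_vector_derivative - (- (A *v H (t - s)))) (at s within {0..t})"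
    for s
    using H unfolding K_def
    by (intro reverse[where G = K and G' = "\<lambda>s. - (A *v H s)", unfolded K_def])
       (auto simp: vector_impulse_response_def intro!: derivative_eq_intros)
  define F where "F s = H (t - s) \<bullet> u s + K (t - s) \<bullet> \<theta> s" for s
  have "(F has_vector_derivative H' (t - s) \<bullet> W s) (at s within {0..t})" if "s \<in> {0..t}" for s
  proof -
    note inner_deriv = bounded_bilinear.has_vector_derivative[OF bounded_bilinear_inner]
    have "(F has_vector_derivative
        (H (t - s) \<bullet> ?f s + - H' (t - s) \<bullet> u s) +
        (K (t - s) \<bullet> \<omega> s + - (- (A *v H (t - s))) \<bullet> \<theta> s)) (at s within {0..t})"
      unfolding F_def
      by (intro has_vector_derivative_add inner_deriv dH dK du d\<theta> that)
    also have "(H (t - s) \<bullet> ?f s + - H' (t - s) \<bullet> u s) +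
        (K (t - s) \<bullet> \<omega> s + - (- (A *v H (t - s))) \<bullet> \<theta> s) = H' (t - s) \<bullet> W s"
      by (simp add: K_def u_def sym inner_diff_right inner_add_left)
    finally show ?thesis .
  qed
  then have "integral {0..t} (\<lambda>s. H' (t - s) \<bullet> W s) = F t - F 0"
    using t by (intro integral_unique fundamental_theorem_of_calculus) auto
  moreover have "F t = d \<bullet> \<theta> t"
    using H by (simp add: F_def K_def vector_impulse_response_def)
  moreover have "F 0 = H t \<bullet> \<omega> 0 + (H' t + \<beta> *\<^sub>R H t) \<bullet> \<theta> 0"
    by (simp add: F_def K_def u_def \<open>W 0 = 0\<close>)
  ultimately show ?thesis by simp
qed

section \<open>Second moments\<close>

lemma integrable_product_of_squares:
  fixes X Y :: "'a \<Rightarrow> real"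
  assumes [measurable]: "X \<in> borel_measurable M" "Y \<in> borel_measurable M"
    and int: "integrable M (\<lambda>w. (X w)\<^sup>2)" "integrable M (\<lambda>w. (Y w)\<^sup>2)"
  shows "integrable M (\<lambda>w. X w * Y w)"
proof (rule Bochner_Integration.integrable_bound)
  show "integrable M (\<lambda>w. (X w)\<^sup>2 + (Y w)\<^sup>2)"
    using int by simp
  show "AE w in M. norm (X w * Y w) \<le> norm ((X w)\<^sup>2 + (Y w)\<^sup>2)"
  proof (rule AE_I2)
    fix w
    have "2 * \<bar>X w\<bar> * \<bar>Y w\<bar> \<le> (X w)\<^sup>2 + (Y w)\<^sup>2"
      using sum_squares_bound[of "\<bar>X w\<bar>" "\<bar>Y w\<bar>"] by simp
    moreover have "0 \<le> \<bar>X w\<bar> * \<bar>Y w\<bar>" by simp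
    ultimately have "\<bar>X w\<bar> * \<bar>Y w\<bar> \<le> (X w)\<^sup>2 + (Y w)\<^sup>2" by linarith
    then show "norm (X w * Y w) \<le> norm ((X w)\<^sup>2 + (Y w)\<^sup>2)"
      by (simp add: abs_mult)
  qed
qed simp

lemma integrable_square_add:
  fixes X Y :: "'a \<Rightarrow> real"
  assumes "X \<in> borel_measurable M" "Y \<in> borel_measurable M"
    and int: "integrable M (\<lambda>w. (X w)\<^sup>2)" "integrable M (\<lambda>w. (Y w)\<^sup>2)"
  shows "integrable M (\<lambda>w. (X w + Y w)\<^sup>2)"
    "(\<integral>w. (X w + Y w)\<^sup>2 \<partial>M) = (\<integral>w. (X w)\<^sup>2 \<partial>M) + 2 * (\<integral>w. X w * Y w \<partial>M) + (\<integral>w. (Y w)\<^sup>2 \<partial>M)"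
proof -
  have XY: "integrable M (\<lambda>w. X w * Y w)"
    using assms by (rule integrable_product_of_squares)
  have sq: "(X w + Y w)\<^sup>2 = (X w)\<^sup>2 + 2 * (X w * Y w) + (Y w)\<^sup>2" for w
    by (simp add: power2_eq_square algebra_simps)
  show "integrable M (\<lambda>w. (X w + Y w)\<^sup>2)"
    unfolding sq using int XY by simp
  show "(\<integral>w. (X w + Y w)\<^sup>2 \<partial>M) = (\<integral>w. (X w)\<^sup>2 \<partial>M) + 2 * (\<integral>w. X w * Y w \<partial>M) + (\<integral>w. (Y w)\<^sup>2 \<partial>M)"
    unfolding sq using int XY by simp
qed

lemma Cauchy_Schwarz_integral:
  fixes X Y :: "'a \<Rightarrow> real"
  assumes "X \<in> borel_measurable M" "Y \<in> borel_measurable M"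
    and int: "integrable M (\<lambda>w. (X w)\<^sup>2)" "integrable M (\<lambda>w. (Y w)\<^sup>2)"
  shows "(\<integral>w. X w * Y w \<partial>M)\<^sup>2 \<le> (\<integral>w. (X w)\<^sup>2 \<partial>M) * (\<integral>w. (Y w)\<^sup>2 \<partial>M)"
proof -
  define a where "a = (\<integral>w. (X w)\<^sup>2 \<partial>M)"
  define p where "p = (\<integral>w. X w * Y w \<partial>M)"
  define q where "q = (\<integral>w. (Y w)\<^sup>2 \<partial>M)"
  have quad: "0 \<le> a + 2 * c * p + c\<^sup>2 * q" for c
  proof -
    have "(\<lambda>w. c * Y w) \<in> borel_measurable M" "integrable M (\<lambda>w. (c * Y w)\<^sup>2)"
      using assms by (auto simp: power_mult_distrib)
    from integrable_square_add(2)[OF assms(1) this(1) int(1) this(2)]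
    have "(\<integral>w. (X w + c * Y w)\<^sup>2 \<partial>M) = a + 2 * c * p + c\<^sup>2 * q"
      by (simp add: a_def p_def q_def power_mult_distrib mult.left_commute)
    moreover have "0 \<le> (\<integral>w. (X w + c * Y w)\<^sup>2 \<partial>M)"
      by simp
    ultimately show ?thesis by simp
  qed
  have "q \<ge> 0" by (simp add: q_def)
  have "p\<^sup>2 \<le> a * q"
  proof (cases "q = 0")
    case True
    have "p = 0"
    proof (rule ccontr)
      assume "p \<noteq> 0"
      then show False
        using quad[of "- (a + 1) / (2 * p)"] True by (simp add: field_simps)
    qed
    then show ?thesis using True by simp
  next
    case False
    then show ?thesis
      using quad[of "- p / q"] \<open>q \<ge> 0\<close> by (simp add: field_simps power2_eq_square)
  qed
  then show ?thesis
    by (simp add: a_def p_def q_def)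
qed

text \<open>
  The initial state may be correlated with the noise, so the mixed term does not vanish; by the
  Cauchy--Schwarz inequality it disappears in the limit together with the second moment of \<open>X\<close>.
\<close>

lemma second_moment_perturbation:
  fixes X Y :: "real \<Rightarrow> 'a \<Rightarrow> real"
  assumes X: "\<And>t. t \<ge> 0 \<Longrightarrow> X t \<in> borel_measurable M"
      "\<And>t. t \<ge> 0 \<Longrightarrow> integrable M (\<lambda>w. (X t w)\<^sup>2)"
    and Y: "\<And>t. t \<ge> 0 \<Longrightarrow> Y t \<in> borel_measurable M"
      "\<And>t. t \<ge> 0 \<Longrightarrow> integrable M (\<lambda>w. (Y t w)\<^sup>2)"
    and lim: "((\<lambda>t. \<integral>w. (X t w)\<^sup>2 \<partial>M) \<longlongrightarrow> 0) at_top" "((\<lambda>t. \<integral>w. (Y t w)\<^sup>2 \<partial>M) \<longlongrightarrow> l) at_top"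
  shows "((\<lambda>t. \<integral>w. (X t w + Y t w)\<^sup>2 \<partial>M) \<longlongrightarrow> l) at_top"
proof -
  have "((\<lambda>t. \<integral>w. X t w * Y t w \<partial>M) \<longlongrightarrow> 0) at_top"
  proof (rule Lim_null_comparison)
    let ?g = "\<lambda>t. sqrt ((\<integral>w. (X t w)\<^sup>2 \<partial>M) * (\<integral>w. (Y t w)\<^sup>2 \<partial>M))"
    show "(?g \<longlongrightarrow> 0) at_top"
      using tendsto_real_sqrt[OF tendsto_mult[OF lim]] by simp
    have "norm (\<integral>w. X t w * Y t w \<partial>M) \<le> ?g t" if "t \<ge> 0" for t
      using Cauchy_Schwarz_integral[OF X(1)[OF that] Y(1)[OF that] X(2)[OF that] Y(2)[OF that]]
      by (intro real_le_rsqrt) simp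
    then show "\<forall>\<^sub>F t in at_top. norm (\<integral>w. X t w * Y t w \<partial>M) \<le> ?g t"
      by (rule eventually_mono[OF eventually_ge_at_top])
  qed
  then have lim': "((\<lambda>t. (\<integral>w. (X t w)\<^sup>2 \<partial>M) + 2 * (\<integral>w. X t w * Y t w \<partial>M) + (\<integral>w. (Y t w)\<^sup>2 \<partial>M))
      \<longlongrightarrow> 0 + 2 * 0 + l) at_top"
    by (intro tendsto_add tendsto_mult tendsto_const lim)
  have "\<forall>\<^sub>F t in at_top. (\<integral>w. (X t w)\<^sup>2 \<partial>M) + 2 * (\<integral>w. X t w * Y t w \<partial>M) +
      (\<integral>w. (Y t w)\<^sup>2 \<partial>M) = (\<integral>w. (X t w + Y t w)\<^sup>2 \<partial>M)"
    using X Y by (intro eventually_mono[OF eventually_ge_at_top[of 0]])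
      (simp add: integrable_square_add(2))
  from Lim_transform_eventually[OF lim' this] show ?thesis
    by simp
qed

section \<open>Joint measurability of continuous processes\<close>

text \<open>
  The process is the pointwise limit of the processes that are frozen at the largest multiple of
  \<open>1 / n\<close> before the current time. These are jointly measurable, being pieced together from
  countably many random variables.
\<close>

lemma continuous_process_measurable:
  fixes V :: "real \<Rightarrow> 'w \<Rightarrow> 'b::metric_space"
  assumes [measurable]: "\<And>t. V t \<in> borel_measurable M"
    and cont: "\<And>w. continuous_on UNIV (\<lambda>t. V t w)"
  shows "(\<lambda>p. V (fst p) (snd p)) \<in> borel_measurable (borel \<Otimes>\<^sub>M M)"
proof (rule borel_measurable_LIMSEQ_metric)
  fix n :: nat
  show "(\<lambda>p. V (real_of_int \<lfloor>real (Suc n) * fst p\<rfloor> / real (Suc n)) (snd p))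
      \<in> borel_measurable (borel \<Otimes>\<^sub>M M)"
    by (rule measurable_compose_countable[where
          f = "\<lambda>i p. V (real_of_int i / real (Suc n)) (snd p)" and
          g = "\<lambda>p. \<lfloor>real (Suc n) * fst p\<rfloor>"]) measurable
next
  fix p :: "real \<times> 'w"
  have "(\<lambda>n. real_of_int \<lfloor>real (Suc n) * fst p\<rfloor> / real (Suc n)) \<longlonglongrightarrow> fst p"
  proof (rule LIM_zero_cancel, rule Lim_null_comparison[OF _ LIMSEQ_inverse_real_of_nat])
    have "\<bar>real_of_int \<lfloor>x * fst p\<rfloor> / x - fst p\<bar> \<le> inverse x" if "x > 0" for x
    proof -
      have eq: "real_of_int \<lfloor>x * fst p\<rfloor> / x - fst p = (real_of_int \<lfloor>x * fst p\<rfloor> - x * fst p) / x"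
        using that by (simp add: diff_divide_distrib)
      have "\<bar>real_of_int \<lfloor>x * fst p\<rfloor> - x * fst p\<bar> \<le> 1"
        by linarith
      then show ?thesis
        unfolding eq abs_divide using that by (simp add: inverse_eq_divide divide_right_mono)
    qed
    then show "\<forall>\<^sub>F n in sequentially.
        norm (real_of_int \<lfloor>real (Suc n) * fst p\<rfloor> / real (Suc n) - fst p) \<le> inverse (real (Suc n))"
      unfolding real_norm_def by (intro always_eventually allI) (metis of_nat_0_less_iff zero_less_Suc)
  qed
  then show "(\<lambda>n. V (real_of_int \<lfloor>real (Suc n) * fst p\<rfloor> / real (Suc n)) (snd p))
      \<longlonglongrightarrow> V (fst p) (snd p)"
    by (rule continuous_on_tendsto_compose[OF cont]) simp_all
qed

section \<open>Integrals against a process with orthogonal increments\<close>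

lemma integrable_product_measure_bounded:
  fixes f :: "'a \<times> 'b \<Rightarrow> real"
  assumes T: "finite_measure T" and M: "finite_measure M"
    and f: "f \<in> borel_measurable (T \<Otimes>\<^sub>M M)"
    and int: "\<And>s. s \<in> space T \<Longrightarrow> integrable M (\<lambda>w. f (s, w))"
    and bound: "\<And>s. s \<in> space T \<Longrightarrow> (\<integral>w. \<bar>f (s, w)\<bar> \<partial>M) \<le> C"
  shows "integrable (T \<Otimes>\<^sub>M M) f"
proof -
  interpret T: finite_measure T by fact
  interpret M: finite_measure M by fact
  interpret pair_sigma_finite T M ..
  show ?thesis
  proof (rule Fubini_integrable[OF f])
    show "integrable T (\<lambda>s. \<integral>w. norm (f (s, w)) \<partial>M)"
    proof (rule T.integrable_const_bound[where B = C])
      show "AE s in T. norm (\<integral>w. norm (f (s, w)) \<partial>M) \<le> C"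
        using bound by (intro AE_I2) simp
      show "(\<lambda>s. \<integral>w. norm (f (s, w)) \<partial>M) \<in> borel_measurable T"
        using f by measurable
    qed
    show "AE s in T. integrable M (\<lambda>w. f (s, w))"
      using int by (intro AE_I2)
  qed
qed

abbreviation interval_measure_on :: "real \<Rightarrow> real measure" where
  "interval_measure_on t \<equiv> restrict_space lborel {0..t}"

lemma finite_interval_measure: "finite_measure (interval_measure_on t)"
  by (rule finite_measureI, cases "0 \<le> t")
     (simp_all add: emeasure_restrict_space space_restrict_space)

lemma interval_measure_integral:
  fixes F :: "real \<Rightarrow> real"
  assumes "continuous_on {0..t} F"
  shows "integrable (interval_measure_on t) F"
    "(\<integral>s. F s \<partial>interval_measure_on t) = integral {0..t} F"
proof -
  have "set_integrable lborel {0..t} F"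
    using assms by (rule borel_integrable_atLeastAtMost')
  then show "integrable (interval_measure_on t) F"
    "(\<integral>s. F s \<partial>interval_measure_on t) = integral {0..t} F"
    using set_borel_integral_eq_integral(2)[of "{0..t}" F]
    by (simp_all add: set_integrable_def set_lebesgue_integral_def integrable_restrict_space
        integral_restrict_space)
qed

text \<open>
  The kernel \<open>min s r\<close> is the covariance of Brownian motion, and its second derivative in \<open>s\<close> is
  minus a point mass at \<open>r\<close>. Integrating \<open>G'\<close> against it by parts on each side of \<open>r\<close> therefore
  gives minus a primitive of \<open>G\<close>.
\<close>

lemma has_integral_min_by_parts:
  fixes G G' :: "real \<Rightarrow> real"
  assumes G: "\<And>s. (G has_real_derivative G' s) (at s)" and "G t = 0" and r: "0 \<le> r" "r \<le> t"
  shows "((\<lambda>s. min s r * G' s) has_integral - integral {0..r} G) {0..t}"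
proof -
  have contG: "continuous_on X G" for X
    using G by (intro DERIV_continuous_on) (auto intro: DERIV_subset)
  define J where "J s = integral {0..s} G" for s
  have J: "(J has_real_derivative G s) (at s within {0..r})" if "s \<in> {0..r}" for s
    unfolding J_def has_real_derivative_iff_has_vector_derivative
    by (rule integral_has_vector_derivative[OF contG that])
  have dG: "(G has_real_derivative G' s) (at s within X)" for s X
    using G by (rule DERIV_subset) auto
  have "((\<lambda>s. s * G' s) has_integral (r * G r - J r) - (0 * G 0 - J 0)) {0..r}"
  proof (rule fundamental_theorem_of_calculus[OF r(1)])
    fix s assume "s \<in> {0..r}"
    then have "((\<lambda>s. s * G s - J s) has_real_derivative s * G' s) (at s within {0..r})"
      by (auto intro!: derivative_eq_intros dG J)
    then show "((\<lambda>s. s * G s - J s) has_vector_derivative s * G' s) (at s within {0..r})"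
      by (simp add: has_real_derivative_iff_has_vector_derivative)
  qed
  then have "((\<lambda>s. s * G' s) has_integral r * G r - J r) {0..r}"
    by (simp add: J_def)
  then have 1: "((\<lambda>s. min s r * G' s) has_integral r * G r - J r) {0..r}"
    by (rule has_integral_eq[rotated]) (simp add: min_def)
  have "((\<lambda>s. r * G' s) has_integral r * G t - r * G r) {r..t}"
  proof (rule fundamental_theorem_of_calculus[OF r(2)])
    fix s
    have "((\<lambda>s. r * G s) has_real_derivative r * G' s) (at s within {r..t})"
      by (auto intro!: derivative_eq_intros dG)
    then show "((\<lambda>s. r * G s) has_vector_derivative r * G' s) (at s within {r..t})"
      by (simp add: has_real_derivative_iff_has_vector_derivative)
  qed
  then have 2: "((\<lambda>s. min s r * G' s) has_integral r * G t - r * G r) {r..t}"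
    by (rule has_integral_eq[rotated]) (simp add: min_def)
  show ?thesis
    using has_integral_combine[OF r 1 2] \<open>G t = 0\<close> by (simp add: J_def)
qed

text \<open>
  Integrated white noise whose paths are continuous without exception and which is given at all
  real times, so that it is jointly measurable in time and chance.
\<close>

locale continuous_white_noise = prob_space M for M :: "'w measure" +
  fixes V :: "real \<Rightarrow> 'w \<Rightarrow> real^'n"
  assumes measurable_V [measurable]: "\<And>t. V t \<in> borel_measurable M"
    and continuous_V: "\<And>w. continuous_on UNIV (\<lambda>t. V t w)"
    and square_integrable_V: "t \<ge> 0 \<Longrightarrow> integrable M (\<lambda>w. (norm (V t w))\<^sup>2)"
    and covariance_V: "s \<ge> 0 \<Longrightarrow> t \<ge> 0 \<Longrightarrow>
      (\<integral>w. V s w $ i * V t w $ j \<partial>M) = (if i = j then min s t else 0)"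
begin

lemma measurable_V_component [measurable]: "(\<lambda>w. V t w $ i) \<in> borel_measurable M"
proof -
  have "(\<lambda>w. V t w \<bullet> axis i 1) \<in> borel_measurable M" by measurable
  then show ?thesis by (simp add: inner_axis)
qed

lemma integrable_V_products:
  assumes "s \<ge> 0" "t \<ge> 0"
  shows "integrable M (\<lambda>w. V s w $ i * V t w $ j)"
proof -
  have "integrable M (\<lambda>w. (V s w $ i)\<^sup>2)" if "s \<ge> 0" for s i
  proof (rule Bochner_Integration.integrable_bound[OF square_integrable_V[OF that]])
    have "(V s w $ i)\<^sup>2 \<le> (norm (V s w))\<^sup>2" for w
      using component_le_norm_cart[of "V s w" i] by (simp add: abs_le_square_iff[symmetric])
    then show "AE w in M. norm ((V s w $ i)\<^sup>2) \<le> norm ((norm (V s w))\<^sup>2)"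
      by simp
  qed measurable
  with assms show ?thesis
    by (intro integrable_product_of_squares) auto
qed

text \<open>
  The identity covariance makes the components along any two vectors behave like scalar Brownian
  motions with correlation \<open>a \<bullet> c\<close>, independently of coordinates.
\<close>

lemma covariance_inner:
  assumes "s \<ge> 0" "t \<ge> 0"
  shows "integrable M (\<lambda>w. (a \<bullet> V s w) * (c \<bullet> V t w))"
    "(\<integral>w. (a \<bullet> V s w) * (c \<bullet> V t w) \<partial>M) = (a \<bullet> c) * min s t"
proof -
  have eq: "(a \<bullet> V s w) * (c \<bullet> V t w) =
      (\<Sum>i\<in>UNIV. \<Sum>j\<in>UNIV. (a $ i * c $ j) * (V s w $ i * V t w $ j))" for w
    by (simp add: inner_vec_def sum_product mult_ac)
  note int = integrable_V_products[OF assms]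
  show "integrable M (\<lambda>w. (a \<bullet> V s w) * (c \<bullet> V t w))"
    unfolding eq by (intro Bochner_Integration.integrable_sum integrable_mult_right int)
  have "(\<integral>w. (a \<bullet> V s w) * (c \<bullet> V t w) \<partial>M) =
      (\<Sum>i\<in>UNIV. \<Sum>j\<in>UNIV. (a $ i * c $ j) * (if i = j then min s t else 0))"
    unfolding eq using int
    by (simp add: Bochner_Integration.integral_sum Bochner_Integration.integrable_sum
        covariance_V[OF assms] cong: if_cong)
  also have "\<dots> = (a \<bullet> c) * min s t"
    by (simp add: inner_vec_def sum_distrib_right if_distrib cong: if_cong)
  finally show "(\<integral>w. (a \<bullet> V s w) * (c \<bullet> V t w) \<partial>M) = (a \<bullet> c) * min s t" .
qed

definition noise_integral :: "(real \<Rightarrow> real^'n) \<Rightarrow> real \<Rightarrow> 'w \<Rightarrow> real" where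
  "noise_integral f t w = integral {0..t} (\<lambda>s. f s \<bullet> V s w)"

text \<open>
  Fubini's theorem for the integral over time and chance. All integrability questions reduce to
  the square of the integrand, whose expectation is bounded on the compact time interval; products
  are then handled by \<open>2 x y \<le> x\<^sup>2 + y\<^sup>2\<close>, and the square of the time integral by the
  Cauchy--Schwarz inequality.
\<close>

lemma noise_integral_square_integrable:
  assumes f: "continuous_on UNIV f"
  shows "noise_integral f t \<in> borel_measurable M"
    and "integrable M (\<lambda>w. (noise_integral f t w)\<^sup>2)"
    and "\<lbrakk>X \<in> borel_measurable M; integrable M (\<lambda>w. (X w)\<^sup>2)\<rbrakk> \<Longrightarrow>
      (\<integral>w. X w * noise_integral f t w \<partial>M) =
      (\<integral>s. (\<integral>w. X w * (f s \<bullet> V s w) \<partial>M) \<partial>interval_measure_on t)"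
proof -
  let ?T = "interval_measure_on t"
  interpret T: finite_measure ?T by (rule finite_interval_measure)
  interpret TM: pair_sigma_finite ?T M ..
  have space_T: "space ?T = {0..t}" by (simp add: space_restrict_space)
  have [measurable]: "(\<lambda>s. s) \<in> measurable ?T borel"
    by (intro measurable_restrict_space1) simp
  have [measurable]: "(\<lambda>p. fst p) \<in> measurable (?T \<Otimes>\<^sub>M M) borel"
    using measurable_compose[OF measurable_fst, of "\<lambda>s. s" ?T borel M] by simp
  have "f \<in> borel_measurable borel"
    using f by (rule borel_measurable_continuous_onI)
  then have [measurable]: "(\<lambda>p. f (fst p)) \<in> borel_measurable (?T \<Otimes>\<^sub>M M)"
    by measurable
  have "(\<lambda>p. (fst p, snd p)) \<in> measurable (?T \<Otimes>\<^sub>M M) (borel \<Otimes>\<^sub>M M)"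
    by (intro measurable_Pair) measurable
  from measurable_compose[OF this continuous_process_measurable[OF measurable_V continuous_V]]
  have [measurable]: "(\<lambda>p. V (fst p) (snd p)) \<in> borel_measurable (?T \<Otimes>\<^sub>M M)"
    by simp
  define g where "g p = f (fst p) \<bullet> V (fst p) (snd p)" for p
  have [measurable]: "g \<in> borel_measurable (?T \<Otimes>\<^sub>M M)"
    unfolding g_def by measurable
  have "continuous_on {0..t} (\<lambda>s. f s \<bullet> f s * s)"
    by (intro continuous_intros continuous_on_subset[OF f]) auto
  then have "bounded ((\<lambda>s. f s \<bullet> f s * s) ` {0..t})"
    by (intro compact_imp_bounded compact_continuous_image) auto
  then obtain C where *: "\<forall>x \<in> (\<lambda>s. f s \<bullet> f s * s) ` {0..t}. norm x \<le> C"
    unfolding bounded_iff by blast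
  have C: "f s \<bullet> f s * s \<le> C" if "s \<in> {0..t}" for s
    using bspec[OF * imageI[OF that]] unfolding real_norm_def by (rule abs_le_D1)
  have g2: "integrable (?T \<Otimes>\<^sub>M M) (\<lambda>p. (g p)\<^sup>2)"
  proof (rule integrable_product_measure_bounded[where C = C])
    show "finite_measure ?T" "finite_measure M" by unfold_locales
    show "(\<lambda>p. (g p)\<^sup>2) \<in> borel_measurable (?T \<Otimes>\<^sub>M M)"
      by measurable
    fix s assume "s \<in> space ?T"
    then have s: "s \<in> {0..t}" "s \<ge> 0" by (auto simp: space_T)
    show "integrable M (\<lambda>w. (g (s, w))\<^sup>2)"
      using covariance_inner(1)[OF s(2) s(2)] by (simp add: g_def power2_eq_square)
    have "(\<integral>w. \<bar>(g (s, w))\<^sup>2\<bar> \<partial>M) = f s \<bullet> f s * s"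
      using covariance_inner(2)[OF s(2) s(2)] by (simp add: g_def power2_eq_square)
    then show "(\<integral>w. \<bar>(g (s, w))\<^sup>2\<bar> \<partial>M) \<le> C"
      using C[OF s(1)] by simp
  qed
  have gX: "integrable (?T \<Otimes>\<^sub>M M) (\<lambda>p. X (snd p) * g p)"
    if [measurable]: "X \<in> borel_measurable M" and X2: "integrable M (\<lambda>w. (X w)\<^sup>2)" for X
  proof (rule integrable_product_of_squares)
    show "integrable (?T \<Otimes>\<^sub>M M) (\<lambda>p. (X (snd p))\<^sup>2)"
      by (rule integrable_product_measure_bounded[where C = "\<integral>w. (X w)\<^sup>2 \<partial>M"])
         (use X2 in \<open>auto intro: T.finite_measure_axioms finite_measure_axioms\<close>)
  qed (use g2 in auto)
  have cont: "continuous_on {0..t} (\<lambda>s. f s \<bullet> V s w)" for w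
    by (intro continuous_intros continuous_on_subset[OF f] continuous_on_subset[OF continuous_V]) auto
  have N: "noise_integral f t w = (\<integral>s. g (s, w) \<partial>?T)" for w
    using interval_measure_integral(2)[OF cont] by (simp add: noise_integral_def g_def)
  have "integrable (?T \<Otimes>\<^sub>M M) g"
    using gX[of "\<lambda>_. 1"] by simp
  then have "integrable M (\<lambda>w. \<integral>s. g (s, w) \<partial>?T)"
    using TM.integrable_snd[of "\<lambda>s w. g (s, w)"] by simp
  then show meas: "noise_integral f t \<in> borel_measurable M"
    using borel_measurable_integrable by (simp add: N[abs_def])
  have "integrable M (\<lambda>w. (\<integral>s. (g (s, w))\<^sup>2 \<partial>?T) * measure ?T (space ?T))"
    using TM.integrable_snd[of "\<lambda>s w. (g (s, w))\<^sup>2"] g2 by (simp add: split_def)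
  then show "integrable M (\<lambda>w. (noise_integral f t w)\<^sup>2)"
  proof (rule Bochner_Integration.integrable_bound)
    show "(\<lambda>w. (noise_integral f t w)\<^sup>2) \<in> borel_measurable M"
      using meas by simp
    show "AE w in M. norm ((noise_integral f t w)\<^sup>2) \<le>
        norm ((\<integral>s. (g (s, w))\<^sup>2 \<partial>?T) * measure ?T (space ?T))"
    proof (rule AE_I2)
      fix w
      have "integrable ?T (\<lambda>s. (f s \<bullet> V s w)\<^sup>2)"
        by (intro interval_measure_integral continuous_intros cont)
      moreover have "(\<lambda>s. f s \<bullet> V s w) \<in> borel_measurable ?T"
        using interval_measure_integral(1)[OF cont] by (rule borel_measurable_integrable)
      ultimately have "(noise_integral f t w)\<^sup>2 \<le> (\<integral>s. (g (s, w))\<^sup>2 \<partial>?T) * measure ?T (space ?T)"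
        using Cauchy_Schwarz_integral[of "\<lambda>s. g (s, w)" ?T "\<lambda>_. 1"]
        unfolding N by (simp add: g_def)
      then show "norm ((noise_integral f t w)\<^sup>2) \<le>
          norm ((\<integral>s. (g (s, w))\<^sup>2 \<partial>?T) * measure ?T (space ?T))"
        by simp
    qed
  qed
  show "(\<integral>w. X w * noise_integral f t w \<partial>M) =
      (\<integral>s. (\<integral>w. X w * (f s \<bullet> V s w) \<partial>M) \<partial>?T)"
    if "X \<in> borel_measurable M" "integrable M (\<lambda>w. (X w)\<^sup>2)"
  proof -
    have "(\<integral>w. X w * noise_integral f t w \<partial>M) = (\<integral>w. (\<integral>s. X w * g (s, w) \<partial>?T) \<partial>M)"
      by (simp add: N)
    also have "\<dots> = (\<integral>s. (\<integral>w. X w * g (s, w) \<partial>M) \<partial>?T)"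
      using gX[OF that] by (intro TM.Fubini_integral) (simp add: split_def)
    finally show ?thesis by (simp add: g_def)
  qed
qed

text \<open>
  Wiener's isometry. As \<open>G t = 0\<close>, and \<open>V 0 = 0\<close> almost surely, the integral of
  \<open>G' \<bullet> V\<close> is minus the stochastic integral of \<open>G\<close> against \<open>dV\<close>, which explains the
  energy of \<open>G\<close> on the right. In terms of \<open>V\<close> itself, the expectation is moved inside twice,
  first to correlate the integral with \<open>V r\<close> and then to correlate it with itself, and each time
  an integration by parts removes a derivative.
\<close>

theorem noise_integral_isometry:
  assumes G: "\<And>s. (G has_vector_derivative G' s) (at s)" and G': "continuous_on UNIV G'"
    and "G t = 0" "t \<ge> 0"
  shows "(\<integral>w. (noise_integral G' t w)\<^sup>2 \<partial>M) = integral {0..t} (\<lambda>s. (norm (G s))\<^sup>2)"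
proof -
  let ?N = "noise_integral G' t"
  let ?T = "interval_measure_on t"
  note N = noise_integral_square_integrable[OF G', where t = t]
  have space_T: "space ?T = {0..t}" by (simp add: space_restrict_space)
  have contG: "continuous_on X G" for X
    using G by (meson continuous_on_eq_continuous_within has_vector_derivative_continuous
        continuous_at_imp_continuous_at_within)
  define J where "J r = integral {0..r} G" for r
  have J_inner: "c \<bullet> J r = integral {0..r} (\<lambda>s. c \<bullet> G s)" for c r
    using integral_linear[OF integrable_continuous_real[OF contG] bounded_linear_inner_right[of c]]
    by (simp add: J_def o_def)
  have cross: "(\<integral>w. (c \<bullet> V r w) * ?N w \<partial>M) = - (c \<bullet> J r)" if "r \<in> {0..t}" for c r
  proof -
    have "integrable M (\<lambda>w. (c \<bullet> V r w)\<^sup>2)"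
      using covariance_inner(1)[of r r c c] that by (simp add: power2_eq_square)
    then have "(\<integral>w. (c \<bullet> V r w) * ?N w \<partial>M) =
        (\<integral>s. (\<integral>w. (c \<bullet> V r w) * (G' s \<bullet> V s w) \<partial>M) \<partial>?T)"
      by (intro N) auto
    also have "\<dots> = (\<integral>s. min s r * (c \<bullet> G' s) \<partial>?T)"
      using that by (intro Bochner_Integration.integral_cong)
        (auto simp: covariance_inner space_T min.commute)
    also have "\<dots> = integral {0..t} (\<lambda>s. min s r * (c \<bullet> G' s))"
      by (intro interval_measure_integral continuous_intros continuous_on_subset[OF G']) auto
    also have "\<dots> = - integral {0..r} (\<lambda>s. c \<bullet> G s)"
    proof (intro integral_unique has_integral_min_by_parts)
      show "((\<lambda>s. c \<bullet> G s) has_real_derivative c \<bullet> G' s) (at s)" for s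
        using bounded_linear.has_vector_derivative[OF bounded_linear_inner_right G]
        by (simp add: has_real_derivative_iff_has_vector_derivative)
    qed (use that \<open>G t = 0\<close> in auto)
    finally show ?thesis by (simp add: J_inner)
  qed
  have "(\<integral>w. (?N w)\<^sup>2 \<partial>M) = (\<integral>s. (\<integral>w. ?N w * (G' s \<bullet> V s w) \<partial>M) \<partial>?T)"
    using N(3)[OF N(1,2)] by (simp add: power2_eq_square)
  also have "\<dots> = (\<integral>s. - (G' s \<bullet> J s) \<partial>?T)"
    using cross
    by (intro Bochner_Integration.integral_cong) (simp_all add: space_T mult.commute[of "?N _"])
  also have "\<dots> = integral {0..t} (\<lambda>s. - (G' s \<bullet> J s))"
  proof (rule interval_measure_integral)
    have "continuous_on {0..t} J"
      unfolding J_def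
      by (intro indefinite_integral_continuous_1 integrable_continuous_real contG)
    then show "continuous_on {0..t} (\<lambda>s. - (G' s \<bullet> J s))"
      by (intro continuous_intros continuous_on_subset[OF G']) auto
  qed
  also have "\<dots> = integral {0..t} (\<lambda>s. (norm (G s))\<^sup>2)"
  proof -
    have "((\<lambda>s. G s \<bullet> G s + G' s \<bullet> J s) has_integral G t \<bullet> J t - G 0 \<bullet> J 0) {0..t}"
    proof (rule fundamental_theorem_of_calculus[OF \<open>t \<ge> 0\<close>])
      fix s assume "s \<in> {0..t}"
      then have "(J has_vector_derivative G s) (at s within {0..t})"
        unfolding J_def by (rule integral_has_vector_derivative[OF contG])
      from bounded_bilinear.has_vector_derivative[OF bounded_bilinear_inner
          has_vector_derivative_at_within[OF G] this]
      show "((\<lambda>s. G s \<bullet> J s) has_vector_derivative G s \<bullet> G s + G' s \<bullet> J s) (at s within {0..t})" .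
    qed
    then have "((\<lambda>s. G s \<bullet> G s + G' s \<bullet> J s) has_integral 0) {0..t}"
      using \<open>G t = 0\<close> by (simp add: J_def)
    moreover have "((\<lambda>s. G s \<bullet> G s) has_integral integral {0..t} (\<lambda>s. G s \<bullet> G s)) {0..t}"
      by (intro integrable_integral integrable_continuous_real continuous_intros contG)
    ultimately have "((\<lambda>s. G s \<bullet> G s - (G s \<bullet> G s + G' s \<bullet> J s)) has_integral
        integral {0..t} (\<lambda>s. G s \<bullet> G s) - 0) {0..t}"
      by (rule has_integral_diff[rotated])
    then have "((\<lambda>s. - (G' s \<bullet> J s)) has_integral integral {0..t} (\<lambda>s. G s \<bullet> G s)) {0..t}"
      by simp
    then show ?thesis
      unfolding power2_norm_eq_inner by (rule integral_unique)
  qed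
  finally show ?thesis .
qed

end

section \<open>The swing equations driven by white noise\<close>

text \<open>
  Redefine the paths to be zero on a null set that contains all discontinuous ones, and constant
  at negative times. Neither changes the moments or the equations almost surely.
\<close>

lemma continuous_version_of_white_noise:
  fixes W :: "real \<Rightarrow> 'w \<Rightarrow> real^'n"
  assumes "prob_space M" and W: "integrated_white_noise M W"
  obtains V where "continuous_white_noise M V" "AE w in M. \<forall>t\<ge>0. V t w = W t w"
proof -
  interpret prob_space M by fact
  have meas [measurable]: "W t \<in> borel_measurable M" if "t \<ge> 0" for t
    using W that by (simp add: integrated_white_noise_def)
  have "AE w in M. continuous_on {0..} (\<lambda>t. W t w)"
    using W by (simp add: integrated_white_noise_def)
  then obtain N where N: "{w \<in> space M. \<not> continuous_on {0..} (\<lambda>t. W t w)} \<subseteq> N"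
    "emeasure M N = 0" "N \<in> sets M"
    by (rule AE_E)
  define V where "V t w = (if w \<in> space M - N then W (max 0 t) w else 0)" for t w
  have [measurable]: "space M - N \<in> sets M"
    using N by auto
  have meas_V [measurable]: "V t \<in> borel_measurable M" for t
  proof -
    have [measurable]: "W (max 0 t) \<in> borel_measurable M"
      by (rule meas) simp
    show ?thesis unfolding V_def by measurable
  qed
  have "AE w in M. w \<notin> N"
    using N by (intro AE_not_in) auto
  then have AE_V: "AE w in M. \<forall>t\<ge>0. V t w = W t w"
    using AE_space by eventually_elim (simp add: V_def max_def)
  have "continuous_white_noise M V"
  proof unfold_locales
    show "V t \<in> borel_measurable M" for t by (rule meas_V)
    show "continuous_on UNIV (\<lambda>t. V t w)" for w
    proof (cases "w \<in> space M - N")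
      case True
      then have "continuous_on {0..} (\<lambda>t. W t w)"
        using N(1) by blast
      then have "continuous_on UNIV (\<lambda>t. W (max 0 t) w)"
        by (rule continuous_on_compose2) (auto intro!: continuous_intros)
      with True show ?thesis by (simp add: V_def)
    next
      case False
      then have "V t w = 0" for t by (auto simp: V_def)
      then show ?thesis by simp
    qed
    show "integrable M (\<lambda>w. (norm (V t w))\<^sup>2)" if "t \<ge> 0" for t
    proof (rule integrable_cong_AE_imp)
      show "integrable M (\<lambda>w. (norm (W t w))\<^sup>2)"
        using W that by (simp add: integrated_white_noise_def)
      show "AE w in M. (norm (W t w))\<^sup>2 = (norm (V t w))\<^sup>2"
        using AE_V by eventually_elim (use that in simp)
    qed measurable
    show "(\<integral>w. V s w $ i * V t w $ j \<partial>M) = (if i = j then min s t else 0)"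
      if "s \<ge> 0" "t \<ge> 0" for s t i j
    proof -
      have comp: "(\<lambda>w. X w $ i) \<in> borel_measurable M"
        if [measurable]: "X \<in> borel_measurable M" for X :: "'w \<Rightarrow> real^'n" and i
      proof -
        have "(\<lambda>w. X w \<bullet> axis i 1) \<in> borel_measurable M" by measurable
        then show ?thesis by (simp add: inner_axis)
      qed
      have "(\<integral>w. V s w $ i * V t w $ j \<partial>M) = (\<integral>w. W s w $ i * W t w $ j \<partial>M)"
      proof (rule integral_cong_AE)
        show "AE w in M. V s w $ i * V t w $ j = W s w $ i * W t w $ j"
          using AE_V by eventually_elim (use that in simp)
      qed (intro borel_measurable_times comp meas_V meas that)+
      then show ?thesis
        using W that by (simp add: integrated_white_noise_def)
    qed
  qed
  then show ?thesis
    using AE_V that by blast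
qed

lemma integral_reverse:
  fixes f :: "real \<Rightarrow> real"
  assumes f: "continuous_on UNIV f" and "t \<ge> 0"
  shows "integral {0..t} (\<lambda>s. f (t - s)) = integral {0..t} f"
proof -
  define F where "F s = integral {0..s} f" for s
  have F: "(F has_real_derivative f s) (at s within {0..t})" if "s \<in> {0..t}" for s
    unfolding F_def has_real_derivative_iff_has_vector_derivative
    by (rule integral_has_vector_derivative[OF continuous_on_subset[OF f] that]) simp
  have "((\<lambda>s. - F (t - s)) has_real_derivative f (t - s)) (at s within {0..t})"
    if "s \<in> {0..t}" for s
  proof -
    have "((\<lambda>s. t - s) has_real_derivative - 1) (at s within {0..t})"
      by (auto intro!: derivative_eq_intros)
    moreover have "(F has_real_derivative f (t - s)) (at (t - s) within (\<lambda>s. t - s) ` {0..t})"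
      using that by (intro DERIV_subset[OF F]) auto
    ultimately have "((\<lambda>s. F (t - s)) has_real_derivative f (t - s) * - 1) (at s within {0..t})"
      using DERIV_image_chain by (fastforce simp: o_def)
    then show ?thesis
      by (auto intro!: derivative_eq_intros)
  qed
  then have "((\<lambda>s. f (t - s)) has_integral - F (t - t) - - F (t - 0)) {0..t}"
    using \<open>t \<ge> 0\<close> by (intro fundamental_theorem_of_calculus)
      (auto simp: has_real_derivative_iff_has_vector_derivative)
  then show ?thesis
    by (simp add: integral_unique F_def)
qed

lemma decaying_response_second_moment:
  fixes X Y :: "'w \<Rightarrow> real^'n" and p q :: "real \<Rightarrow> real^'n"
  assumes [measurable]: "X \<in> borel_measurable M" "Y \<in> borel_measurable M"
    and int: "integrable M (\<lambda>w. (norm (X w))\<^sup>2)" "integrable M (\<lambda>w. (norm (Y w))\<^sup>2)"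
  shows "integrable M (\<lambda>w. (p t \<bullet> X w + q t \<bullet> Y w)\<^sup>2)"
    and "(p \<longlongrightarrow> 0) at_top \<Longrightarrow> (q \<longlongrightarrow> 0) at_top \<Longrightarrow>
      ((\<lambda>t. \<integral>w. (p t \<bullet> X w + q t \<bullet> Y w)\<^sup>2 \<partial>M) \<longlongrightarrow> 0) at_top"
proof -
  let ?bd = "\<lambda>t w. 2 * (norm (p t))\<^sup>2 * (norm (X w))\<^sup>2 + 2 * (norm (q t))\<^sup>2 * (norm (Y w))\<^sup>2"
  have bound: "(p t \<bullet> X w + q t \<bullet> Y w)\<^sup>2 \<le> ?bd t w" for t w
  proof -
    have "(p t \<bullet> X w + q t \<bullet> Y w)\<^sup>2 \<le> 2 * (p t \<bullet> X w)\<^sup>2 + 2 * (q t \<bullet> Y w)\<^sup>2"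
      using sum_squares_bound[of "p t \<bullet> X w" "q t \<bullet> Y w"] by (simp add: power2_sum)
    also have "\<dots> \<le> 2 * ((norm (p t))\<^sup>2 * (norm (X w))\<^sup>2) + 2 * ((norm (q t))\<^sup>2 * (norm (Y w))\<^sup>2)"
      unfolding power2_norm_eq_inner by (intro add_mono mult_left_mono Cauchy_Schwarz_ineq) auto
    finally show ?thesis by (simp add: mult.assoc)
  qed
  have int_bd: "integrable M (?bd t)" for t
    using int by simp
  show int_sq: "integrable M (\<lambda>w. (p t \<bullet> X w + q t \<bullet> Y w)\<^sup>2)" for t
  proof (rule Bochner_Integration.integrable_bound[OF int_bd[of t]])
    show "AE w in M. norm ((p t \<bullet> X w + q t \<bullet> Y w)\<^sup>2) \<le> norm (?bd t w)"
      using bound by (intro AE_I2) (smt (verit) real_norm_def zero_le_power2)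
  qed measurable
  assume lim: "(p \<longlongrightarrow> 0) at_top" "(q \<longlongrightarrow> 0) at_top"
  let ?g = "\<lambda>t. 2 * (norm (p t))\<^sup>2 * (\<integral>w. (norm (X w))\<^sup>2 \<partial>M) + 2 * (norm (q t))\<^sup>2 * (\<integral>w. (norm (Y w))\<^sup>2 \<partial>M)"
  show "((\<lambda>t. \<integral>w. (p t \<bullet> X w + q t \<bullet> Y w)\<^sup>2 \<partial>M) \<longlongrightarrow> 0) at_top"
  proof (rule Lim_null_comparison)
    have "(\<integral>w. (p t \<bullet> X w + q t \<bullet> Y w)\<^sup>2 \<partial>M) \<le> (\<integral>w. ?bd t w \<partial>M)" for t
      using int_sq int_bd bound by (rule integral_mono)
    then show "\<forall>\<^sub>F t in at_top. norm (\<integral>w. (p t \<bullet> X w + q t \<bullet> Y w)\<^sup>2 \<partial>M) \<le> ?g t"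
      using int by (intro always_eventually allI) simp
    have "(?g \<longlongrightarrow> 2 * (norm (0::real^'n))\<^sup>2 * (\<integral>w. (norm (X w))\<^sup>2 \<partial>M) +
        2 * (norm (0::real^'n))\<^sup>2 * (\<integral>w. (norm (Y w))\<^sup>2 \<partial>M)) at_top"
      by (intro tendsto_add tendsto_mult tendsto_const tendsto_power tendsto_norm lim)
    then show "(?g \<longlongrightarrow> 0) at_top" by simp
  qed
qed

text \<open>
  Almost surely the phase difference across \<open>e\<close> is the sum of the response to the initial state
  and of an integral against the noise. The first decays in mean square. By the isometry the second
  moment of the other is the energy of the impulse response up to time \<open>t\<close>, which tends to
  \<open>d \<bullet> L\<^sup>\<dagger> d / (2 \<beta>)\<close>, the effective reactance over \<open>2 \<beta>\<close>.
\<close>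

lemma (in network) edge_second_moment:
  fixes M :: "'w measure" and W \<theta> \<omega> :: "real \<Rightarrow> 'w \<Rightarrow> real^'n"
  assumes "prob_space M" and "\<beta> > 0" and W: "integrated_white_noise M W"
    and sol: "swing_solution M (laplacian E b) \<beta> W \<theta> \<omega>" and e: "e \<in> E"
  shows "t \<ge> 0 \<Longrightarrow> integrable M (\<lambda>w. (edge_vector e \<bullet> \<theta> t w)\<^sup>2)"
    and "((\<lambda>t. \<integral>w. (edge_vector e \<bullet> \<theta> t w)\<^sup>2 \<partial>M) \<longlongrightarrow>
      effective_reactance E b e / (2 * \<beta>)) at_top"
proof -
  let ?d = "edge_vector e"
  obtain V where V: "continuous_white_noise M V" and VW: "AE w in M. \<forall>t\<ge>0. V t w = W t w"
    using continuous_version_of_white_noise[OF \<open>prob_space M\<close> W] by blast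
  interpret V: continuous_white_noise M V by (rule V)
  obtain H H' where H: "vector_impulse_response \<beta> (laplacian E b) ?d H H'"
    and energy: "((\<lambda>t. integral {0..t} (\<lambda>s. (norm (H s))\<^sup>2)) \<longlongrightarrow>
       ?d \<bullet> (pseudo_inverse (laplacian E b) *v ?d) / (2 * \<beta>)) at_top"
  proof (rule vector_impulse_response_exists[OF \<open>\<beta> > 0\<close> ev_nonneg])
    show "v \<bullet> ?d = 0" if "ev v = 0" for v
      using kernel_edge_vector[OF that e] by (simp add: inner_commute)
  qed blast
  have dH: "(H has_vector_derivative H' t) (at t)" and dH': "continuous_on X H'"
    and contH: "continuous_on X H" for t X
    using H unfolding vector_impulse_response_def continuous_on_eq_continuous_within
    by (meson has_vector_derivative_continuous continuous_at_imp_continuous_at_within)+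
  define K where "K t = H' t + \<beta> *\<^sub>R H t" for t
  define D where "D t w = H t \<bullet> \<omega> 0 w + K t \<bullet> \<theta> 0 w" for t w
  define N where "N t = V.noise_integral (\<lambda>s. H' (t - s)) t" for t
  have meas\<theta>: "\<theta> t \<in> borel_measurable M" "\<omega> t \<in> borel_measurable M" if "t \<ge> 0" for t
    using sol that by (auto simp: swing_solution_def)
  then have [measurable]: "\<theta> 0 \<in> borel_measurable M" "\<omega> 0 \<in> borel_measurable M"
    by auto
  have int0: "integrable M (\<lambda>w. (norm (\<omega> 0 w))\<^sup>2)" "integrable M (\<lambda>w. (norm (\<theta> 0 w))\<^sup>2)"
    using sol by (auto simp: swing_solution_def)
  have "(K \<longlongrightarrow> 0 + \<beta> *\<^sub>R 0) at_top"
    unfolding K_def using H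
    by (intro tendsto_add tendsto_scaleR tendsto_const) (auto simp: vector_impulse_response_def)
  then have K0: "(K \<longlongrightarrow> 0) at_top" and H0: "(H \<longlongrightarrow> 0) at_top"
    using H by (auto simp: vector_impulse_response_def)
  have D: "D t \<in> borel_measurable M" "integrable M (\<lambda>w. (D t w)\<^sup>2)" for t
    unfolding D_def by (measurable, rule decaying_response_second_moment(1)[OF _ _ int0]) auto
  have D0: "((\<lambda>t. \<integral>w. (D t w)\<^sup>2 \<partial>M) \<longlongrightarrow> 0) at_top"
    unfolding D_def by (rule decaying_response_second_moment(2)[OF _ _ int0 H0 K0]) auto
  have contH': "continuous_on UNIV (\<lambda>s. H' (t - s))" for t
    by (rule continuous_on_compose2[OF dH'[of UNIV]]) (auto intro!: continuous_intros)
  have N: "N t \<in> borel_measurable M" "integrable M (\<lambda>w. (N t w)\<^sup>2)" for t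
    unfolding N_def by (rule V.noise_integral_square_integrable[OF contH'])+
  \<comment> \<open>The isometry applies to the time-reversed response, which vanishes at \<open>s = t\<close>
    because \<open>H 0 = 0\<close>.\<close>
  have N2: "(\<integral>w. (N t w)\<^sup>2 \<partial>M) = integral {0..t} (\<lambda>s. (norm (H s))\<^sup>2)" if "t \<ge> 0" for t
  proof -
    have "((\<lambda>s. - H (t - s)) has_vector_derivative H' (t - s)) (at s)" for s
    proof -
      have "((\<lambda>s. t - s) has_vector_derivative - 1) (at s)"
        by (auto intro!: derivative_eq_intros)
      from vector_diff_chain_at[OF this dH]
      have "((\<lambda>s. H (t - s)) has_vector_derivative - H' (t - s)) (at s)"
        by (simp add: o_def)
      from has_vector_derivative_minus[OF this] show ?thesis by simp
    qed
    then have "(\<integral>w. (N t w)\<^sup>2 \<partial>M) = integral {0..t} (\<lambda>s. (norm (- H (t - s)))\<^sup>2)"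
      unfolding N_def using H that
      by (intro V.noise_integral_isometry contH') (auto simp: vector_impulse_response_def)
    also have "\<dots> = integral {0..t} (\<lambda>s. (norm (H s))\<^sup>2)"
      using integral_reverse[OF _ that, of "\<lambda>s. (norm (H s))\<^sup>2"]
      by (simp add: continuous_on_power continuous_on_norm contH)
    finally show ?thesis .
  qed
  have "((\<lambda>t. \<integral>w. (N t w)\<^sup>2 \<partial>M) \<longlongrightarrow> effective_reactance E b e / (2 * \<beta>)) at_top"
    unfolding effective_reactance_eq[OF simple e]
    by (rule Lim_transform_eventually[OF energy eventually_mono[OF eventually_ge_at_top[of 0]]])
       (simp add: N2)
  then have lim: "((\<lambda>t. \<integral>w. (D t w + N t w)\<^sup>2 \<partial>M) \<longlongrightarrow> effective_reactance E b e / (2 * \<beta>)) at_top"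
    using D N D0 by (intro second_moment_perturbation)
  have "AE w in M. \<forall>t\<ge>0. ?d \<bullet> \<theta> t w = D t w + N t w"
  proof -
    have "AE w in M. \<forall>t\<ge>0.
        ((\<lambda>s. \<omega> s w) has_integral (\<theta> t w - \<theta> 0 w)) {0..t} \<and>
        ((\<lambda>s. - (laplacian E b *v \<theta> s w) - \<beta> *\<^sub>R \<omega> s w) has_integral
           (\<omega> t w - \<omega> 0 w - W t w)) {0..t}"
      using sol by (simp add: swing_solution_def)
    then show ?thesis
      using VW
    proof eventually_elim
      fix w
      assume path: "\<forall>t\<ge>0.
        ((\<lambda>s. \<omega> s w) has_integral (\<theta> t w - \<theta> 0 w)) {0..t} \<and>
        ((\<lambda>s. - (laplacian E b *v \<theta> s w) - \<beta> *\<^sub>R \<omega> s w) has_integral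
           (\<omega> t w - \<omega> 0 w - W t w)) {0..t}"
        and eq: "\<forall>t\<ge>0. V t w = W t w"
      show "\<forall>t\<ge>0. ?d \<bullet> \<theta> t w = D t w + N t w"
      proof (intro allI impI)
        fix t :: real assume "t \<ge> 0"
        have "continuous_on {0..} (\<lambda>t. V t w)"
          using V.continuous_V by (rule continuous_on_subset) simp
        from variation_of_constants[OF laplacian_self_adjoint[OF simple] H this, of "\<lambda>s. \<omega> s w" "\<lambda>s. \<theta> s w" t] path eq \<open>t \<ge> 0\<close>
        show "?d \<bullet> \<theta> t w = D t w + N t w"
          by (simp add: D_def N_def K_def V.noise_integral_def)
      qed
    qed
  qed
  then have AE: "AE w in M. (D t w + N t w)\<^sup>2 = (?d \<bullet> \<theta> t w)\<^sup>2" if "t \<ge> 0" for t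
    by eventually_elim (use that in simp)
  have meas: "(\<lambda>w. (?d \<bullet> \<theta> t w)\<^sup>2) \<in> borel_measurable M" if "t \<ge> 0" for t
    using meas\<theta>(1)[OF that] by measurable
  show "integrable M (\<lambda>w. (?d \<bullet> \<theta> t w)\<^sup>2)" if "t \<ge> 0" for t
    using integrable_square_add(1)[OF D(1) N(1) D(2) N(2)] meas[OF that] AE[OF that]
    by (rule integrable_cong_AE_imp)
  have "(\<integral>w. (D t w + N t w)\<^sup>2 \<partial>M) = (\<integral>w. (?d \<bullet> \<theta> t w)\<^sup>2 \<partial>M)" if "t \<ge> 0" for t
    using D(1)[of t] N(1)[of t] meas[OF that] AE[OF that] by (intro integral_cong_AE) auto
  then show "((\<lambda>t. \<integral>w. (?d \<bullet> \<theta> t w)\<^sup>2 \<partial>M) \<longlongrightarrow> effective_reactance E b e / (2 * \<beta>)) at_top"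
    by (intro Lim_transform_eventually[OF lim eventually_mono[OF eventually_ge_at_top[of 0]]])
qed

lemma (in network) effective_reactance_nonneg:
  "e \<in> E \<Longrightarrow> effective_reactance E b e \<ge> 0"
  using ev_nonneg by (simp add: effective_reactance_sum sum_nonneg)

section \<open>The expected power loss\<close>

theorem theorem18:
  fixes E :: "'n::finite set set"
    and g b :: "'n set \<Rightarrow> real"
    and \<beta> :: real
    and M :: "'w measure"
    and W \<theta> \<omega> :: "real \<Rightarrow> 'w \<Rightarrow> real^'n"
  assumes "simple_graph E" and "graph_connected E" and "CARD('n) \<ge> 2"
    and "\<forall>e\<in>E. g e \<ge> 0" and "\<forall>e\<in>E. b e > 0"
    and "\<beta> > 0"
    and "prob_space M"
    and "integrated_white_noise M W"
    and "swing_solution M (laplacian E b) \<beta> W \<theta> \<omega>"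
  shows
    "let n = real CARD('n);
         \<alpha> = (\<lambda>e. g e / b e);
         \<nu> = (\<lambda>e. effective_reactance E b e * b e);
         \<alpha>bar = (\<Sum>e\<in>E. \<nu> e * \<alpha> e) / (\<Sum>e\<in>E. \<nu> e);
         \<rho> = performance_measure M E g \<theta>
     in (\<forall>t\<ge>0. integrable M (\<lambda>w. power_loss E g (\<theta> t w))) \<and>
        (expected_power_loss M E g \<theta> \<longlongrightarrow> \<rho>) at_top \<and>
        \<rho> = \<alpha>bar / (2 * \<beta>) * (n - 1) \<and>
        \<alpha>bar = (\<Sum>e\<in>E. \<nu> e * \<alpha> e) / (n - 1) \<and>
        Min (\<alpha> ` E) / (2 * \<beta>) * (n - 1) \<le> \<rho> \<and>
        \<rho> \<le> Max (\<alpha> ` E) / (2 * \<beta>) * (n - 1)"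
proof -
  obtain B where "eigenbasis (laplacian E b) B"
    using symmetric_matrix_eigenbasis[OF laplacian_self_adjoint[OF assms(1)]] by blast
  then interpret network E b B
    using assms by unfold_locales (auto simp: eigenbasis_def)
  note moment = edge_second_moment[OF assms(7,6,8,9)]
  define r where "r = effective_reactance E b"
  define \<alpha> where "\<alpha> e = g e / b e" for e
  define m where "m = real CARD('n) - 1"
  have m: "m > 0" "(\<Sum>e\<in>E. r e * b e) = m"
    using assms(3) foster by (auto simp: m_def r_def)
  have loss: "power_loss E g x = (\<Sum>e\<in>E. g e * (edge_vector e \<bullet> x)\<^sup>2)" for x
    unfolding power_loss_def using edge_value_power[OF simple] by (intro sum.cong) auto
  have integrable_loss: "integrable M (\<lambda>w. power_loss E g (\<theta> t w))" if "t \<ge> 0" for t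
    unfolding loss using moment(1) that by (intro Bochner_Integration.integrable_sum) auto
  have "expected_power_loss M E g \<theta> t = (\<Sum>e\<in>E. g e * (\<integral>w. (edge_vector e \<bullet> \<theta> t w)\<^sup>2 \<partial>M))"
    if "t \<ge> 0" for t
    unfolding expected_power_loss_def loss using moment(1) that
    by (subst Bochner_Integration.integral_sum) auto
  then have "\<forall>\<^sub>F t in at_top. (\<Sum>e\<in>E. g e * (\<integral>w. (edge_vector e \<bullet> \<theta> t w)\<^sup>2 \<partial>M)) =
      expected_power_loss M E g \<theta> t"
    by (intro eventually_mono[OF eventually_ge_at_top[of 0]]) simp
  moreover have "((\<lambda>t. \<Sum>e\<in>E. g e * (\<integral>w. (edge_vector e \<bullet> \<theta> t w)\<^sup>2 \<partial>M)) \<longlongrightarrow>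
      (\<Sum>e\<in>E. g e * (r e / (2 * \<beta>)))) at_top"
    unfolding r_def by (intro tendsto_sum tendsto_mult tendsto_const moment(2))
  \<comment> \<open>Here the conductances turn into the ratios \<open>\<alpha>\<close>: \<open>g r = (r b) (g / b) = \<nu> \<alpha>\<close>.\<close>
  moreover have "(\<Sum>e\<in>E. g e * (r e / (2 * \<beta>))) = (\<Sum>e\<in>E. r e * b e * \<alpha> e) / (2 * \<beta>)"
    unfolding sum_divide_distrib
    using weight_pos by (intro sum.cong refl) (force simp: \<alpha>_def field_simps)
  ultimately have lim: "(expected_power_loss M E g \<theta> \<longlongrightarrow> (\<Sum>e\<in>E. r e * b e * \<alpha> e) / (2 * \<beta>)) at_top"
    using Lim_transform_eventually by fastforce
  then have \<rho>: "performance_measure M E g \<theta> = (\<Sum>e\<in>E. r e * b e * \<alpha> e) / (2 * \<beta>)"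
    unfolding performance_measure_def by (intro tendsto_Lim) auto
  have \<nu>: "0 \<le> r e * b e" if "e \<in> E" for e
    using that effective_reactance_nonneg weight_pos by (simp add: r_def less_imp_le)
  have "Min (\<alpha> ` E) * m = (\<Sum>e\<in>E. r e * b e * Min (\<alpha> ` E))"
    by (simp add: sum_distrib_right[symmetric] m)
  also have "\<dots> \<le> (\<Sum>e\<in>E. r e * b e * \<alpha> e)"
    using \<nu> by (intro sum_mono mult_left_mono) auto
  finally have lower: "Min (\<alpha> ` E) * m \<le> (\<Sum>e\<in>E. r e * b e * \<alpha> e)" .
  have "(\<Sum>e\<in>E. r e * b e * \<alpha> e) \<le> (\<Sum>e\<in>E. r e * b e * Max (\<alpha> ` E))"
    using \<nu> by (intro sum_mono mult_left_mono) auto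
  also have "\<dots> = Max (\<alpha> ` E) * m"
    by (simp add: sum_distrib_right[symmetric] m)
  finally have upper: "(\<Sum>e\<in>E. r e * b e * \<alpha> e) \<le> Max (\<alpha> ` E) * m" .
  show ?thesis
    unfolding Let_def r_def[symmetric] m_def[symmetric] \<alpha>_def[abs_def, symmetric] \<alpha>_def[symmetric]
    using integrable_loss lim lower upper m \<open>\<beta> > 0\<close>
    by (auto simp: \<rho> divide_right_mono)
qed

end
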